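(* Let $\pi\colon (X,G)\to (Y,G)$ be a factor map between minimal topological dynamical systems with $h_{\mathrm{top}}(G\mid\pi)>0$. Then for every integer $n\ge 2$, $\pi$ is relative mean $n$-sensitive with respect to $\mathcal{F}$.
   Context: Standing setting: $G$ is a countable discrete infinite amenable group and $\mathcal{F}=\{F_m\}_{m=1}^\infty$ is a fixed (two-sided) F{\o}lner sequence of $G$, i.e. each $F_m\subset G$ is finite and non-empty and for every $g\in G$, $\lim_{m\to\infty}|gF_m\Delta F_m|/|F_m|=0$ and $\lim_{m\to\infty}|F_mg\Delta F_m|/|F_m|=0$. A topological dynamical system (TDS) $(X,G)$ is a compact metric space $X$ (with metric $d$) with a continuous action $G\times X\to X$, $(g,x)\mapsto gx$. It is minimal if every orbit $\{gx: g\in G\}$, $x\in X$, is dense in $X$. A factor map $\pi\colon (X,G)\to(Y,G)$ is a continuous surjection $\pi\colon X\to Y$ with $\pi(gx)=g\pi(x)$ for all $g\in G$, $x\in X$. Relative topological entropy: for a finite open cover $\mathcal{U}$ of $X$ and $E\subseteq X$, $N(\mathcal{U},E)$ is the minimal cardinality of a subfamily of $\mathcal{U}$ whose union covers $E$; $N(\mathcal{U}\mid\pi)=\sup_{y\in Y}N(\mathcal{U},\pi^{-1}(y))$, $H(\mathcal{U}\mid\pi)=\log N(\mathcal{U}\mid\pi)$; $h_{\mathrm{top}}(G,\mathcal{U}\mid\pi)=\lim_{m\to\infty}\frac{1}{|F_m|}H\big(\bigvee_{g\in F_m}g^{-1}\mathcal{U}\mid\pi\big)$ (the limit exists and does not depend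 on the F{\o}lner sequence), where $\mathcal{U}\vee\mathcal{V}=\{U\cap V:U\in\mathcal{U},V\in\mathcal{V}\}$; and $h_{\mathrm{top}}(G\mid\pi)=\sup_{\mathcal{U}}h_{\mathrm{top}}(G,\mathcal{U}\mid\pi)$ over all finite open covers $\mathcal{U}$ of $X$. Relative mean $n$-sensitivity: for $n\ge 2$, $\pi$ is relative mean $n$-sensitive with respect to $\mathcal{F}$ if there is $\epsilon>0$ such that for any non-empty open subset $U$ of $X$ there are $n$ distinct points $x_1,\dots,x_n\in U$ with $\pi(x_1)=\cdots=\pi(x_n)$ and $\limsup_{m\to\infty}\frac{1}{|F_m|}\sum_{g\in F_m}\min_{1\le i\ne j\le n}d(gx_i,gx_j)>\epsilon$. *)

theory Defs
  imports "HOL-Analysis.Analysis" "HOL-Algebra.Group_Action"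
begin

section \<open>Amenability and Folner sequences\<close>

text \<open>Amenability of a discrete group, in von Neumann's form: there is a left-invariant finitely
  additive probability measure on all subsets.\<close>

definition amenable :: "('g, 'b) monoid_scheme \<Rightarrow> bool" where
  "amenable G \<longleftrightarrow> group G \<and>
     (\<exists>\<mu> :: 'g set \<Rightarrow> real.
        (\<forall>A \<subseteq> carrier G. 0 \<le> \<mu> A) \<and> \<mu> (carrier G) = 1 \<and>
        (\<forall>A \<subseteq> carrier G. \<forall>B \<subseteq> carrier G. A \<inter> B = {} \<longrightarrow> \<mu> (A \<union> B) = \<mu> A + \<mu> B) \<and>
        (\<forall>g \<in> carrier G. \<forall>A \<subseteq> carrier G. \<mu> (g <#\<^bsub>G\<^esub> A) = \<mu> A))"

definition folner_sequence :: "('g, 'b) monoid_scheme \<Rightarrow> (nat \<Rightarrow> 'g set) \<Rightarrow> bool" where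
  "folner_sequence G F \<longleftrightarrow>
     (\<forall>m. finite (F m) \<and> F m \<noteq> {} \<and> F m \<subseteq> carrier G) \<and>
     (\<forall>g \<in> carrier G.
        (\<lambda>m. real (card (sym_diff (g <#\<^bsub>G\<^esub> F m) (F m))) / real (card (F m))) \<longlonglongrightarrow> 0 \<and>
        (\<lambda>m. real (card (sym_diff (F m #>\<^bsub>G\<^esub> g) (F m))) / real (card (F m))) \<longlonglongrightarrow> 0)"

section \<open>Topological dynamical systems\<close>

text \<open>The phase space is a compact subset of a metric space type, with the restricted metric.
  The locale \<open>group_action\<close> takes values in \<open>BijGroup X\<close>, so each \<open>act g\<close> is \<open>undefined\<close>
  outside \<open>X\<close>.\<close>

definition tds ::
  "('g, 'b) monoid_scheme \<Rightarrow> 'x::metric_space set \<Rightarrow> ('g \<Rightarrow> 'x \<Rightarrow> 'x) \<Rightarrow> bool" where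
  "tds G X act \<longleftrightarrow> compact X \<and> group_action G X act \<and>
     continuous_map (prod_topology (discrete_topology (carrier G)) (top_of_set X)) (top_of_set X)
       (\<lambda>(g, x). act g x)"

definition minimal_tds ::
  "('g, 'b) monoid_scheme \<Rightarrow> 'x::metric_space set \<Rightarrow> ('g \<Rightarrow> 'x \<Rightarrow> 'x) \<Rightarrow> bool" where
  "minimal_tds G X act \<longleftrightarrow> tds G X act \<and>
     (\<forall>x \<in> X. top_of_set X closure_of (orbit G act x) = X)"

definition factor_map ::
  "('g, 'b) monoid_scheme \<Rightarrow> 'x::metric_space set \<Rightarrow> ('g \<Rightarrow> 'x \<Rightarrow> 'x) \<Rightarrow>
     'y::metric_space set \<Rightarrow> ('g \<Rightarrow> 'y \<Rightarrow> 'y) \<Rightarrow> ('x \<Rightarrow> 'y) \<Rightarrow> bool" where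
  "factor_map G X actX Y actY \<pi> \<longleftrightarrow> tds G X actX \<and> tds G Y actY \<and>
     continuous_on X \<pi> \<and> \<pi> ` X = Y \<and>
     (\<forall>g \<in> carrier G. \<forall>x \<in> X. \<pi> (actX g x) = actY g (\<pi> x))"

section \<open>Relative topological entropy\<close>

definition finite_open_cover :: "'x::topological_space set \<Rightarrow> 'x set set \<Rightarrow> bool" where
  "finite_open_cover X \<U> \<longleftrightarrow>
     finite \<U> \<and> (\<forall>U \<in> \<U>. openin (top_of_set X) U) \<and> \<Union>\<U> = X"

definition cover_join :: "'x set set \<Rightarrow> 'x set set \<Rightarrow> 'x set set" where
  "cover_join \<U> \<V> = {U \<inter> V | U V. U \<in> \<U> \<and> V \<in> \<V>}"

text \<open>Join of a finite, non-empty indexed family of covers; the two lemmas below identify it with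
  the iterated binary join.\<close>

definition cover_Join :: "'i set \<Rightarrow> ('i \<Rightarrow> 'x set set) \<Rightarrow> 'x set set" where
  "cover_Join I \<U> = {\<Inter>i\<in>I. V i | V. \<forall>i\<in>I. V i \<in> \<U> i}"

lemma cover_Join_singleton: "cover_Join {i} \<U> = \<U> i"
  unfolding cover_Join_def by (auto intro: exI[of _ "\<lambda>_. _"])

lemma cover_Join_insert:
  assumes "i \<notin> I"
  shows "cover_Join (insert i I) \<U> = cover_join (\<U> i) (cover_Join I \<U>)"
proof
  show "cover_Join (insert i I) \<U> \<subseteq> cover_join (\<U> i) (cover_Join I \<U>)"
    unfolding cover_Join_def cover_join_def by fastforce
  show "cover_join (\<U> i) (cover_Join I \<U>) \<subseteq> cover_Join (insert i I) \<U>"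
  proof
    fix W assume "W \<in> cover_join (\<U> i) (cover_Join I \<U>)"
    then obtain U V where UV: "W = U \<inter> (\<Inter>j\<in>I. V j)" "U \<in> \<U> i" "\<forall>j\<in>I. V j \<in> \<U> j"
      unfolding cover_Join_def cover_join_def by blast
    have "(\<Inter>j\<in>I. (V(i := U)) j) = (\<Inter>j\<in>I. V j)"
      using assms by (intro INF_cong) auto
    then have "W = (\<Inter>j\<in>insert i I. (V(i := U)) j)"
      using UV(1) by (simp only: INF_insert fun_upd_same)
    moreover have "\<forall>j\<in>insert i I. (V(i := U)) j \<in> \<U> j"
      using UV assms by auto
    ultimately show "W \<in> cover_Join (insert i I) \<U>"
      unfolding cover_Join_def by blast
  qed
qed

definition translate_cover :: "'x set \<Rightarrow> ('g \<Rightarrow> 'x \<Rightarrow> 'x) \<Rightarrow> 'g \<Rightarrow> 'x set set \<Rightarrow> 'x set set" where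
  "translate_cover X act g \<U> = (\<lambda>U. {x \<in> X. act g x \<in> U}) ` \<U>"

definition cover_number :: "'x set set \<Rightarrow> 'x set \<Rightarrow> nat" where
  "cover_number \<U> E = (LEAST k. \<exists>\<V> \<subseteq> \<U>. finite \<V> \<and> card \<V> = k \<and> E \<subseteq> \<Union>\<V>)"

definition rel_cover_number ::
  "'x set \<Rightarrow> 'y set \<Rightarrow> ('x \<Rightarrow> 'y) \<Rightarrow> 'x set set \<Rightarrow> nat" where
  "rel_cover_number X Y \<pi> \<U> = (SUP y \<in> Y. cover_number \<U> {x \<in> X. \<pi> x = y})"

definition rel_cover_entropy ::
  "'x set \<Rightarrow> 'y set \<Rightarrow> ('x \<Rightarrow> 'y) \<Rightarrow> 'x set set \<Rightarrow> real" where
  "rel_cover_entropy X Y \<pi> \<U> = ln (real (rel_cover_number X Y \<pi> \<U>))"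

text \<open>For a Folner sequence \<open>F\<close> the limit exists and does not depend on \<open>F\<close> (Ornstein--Weiss).\<close>

definition rel_entropy_cover ::
  "(nat \<Rightarrow> 'g set) \<Rightarrow> 'x set \<Rightarrow> ('g \<Rightarrow> 'x \<Rightarrow> 'x) \<Rightarrow> 'y set \<Rightarrow> ('x \<Rightarrow> 'y) \<Rightarrow> 'x set set \<Rightarrow> real" where
  "rel_entropy_cover F X act Y \<pi> \<U> =
     lim (\<lambda>m. rel_cover_entropy X Y \<pi>
                 (cover_Join (F m) (\<lambda>g. translate_cover X act g \<U>)) / real (card (F m)))"

definition rel_top_entropy ::
  "(nat \<Rightarrow> 'g set) \<Rightarrow> 'x::topological_space set \<Rightarrow> ('g \<Rightarrow> 'x \<Rightarrow> 'x) \<Rightarrow> 'y set \<Rightarrow> ('x \<Rightarrow> 'y) \<Rightarrow> ereal"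
  where
  "rel_top_entropy F X act Y \<pi> =
     (SUP \<U> \<in> {\<U>. finite_open_cover X \<U>}. ereal (rel_entropy_cover F X act Y \<pi> \<U>))"

section \<open>Relative mean sensitivity\<close>

text \<open>Intended for \<open>n \<ge> 2\<close>; for smaller \<open>n\<close> the minimum is over the empty set.\<close>

definition rel_mean_sensitive ::
  "nat \<Rightarrow> (nat \<Rightarrow> 'g set) \<Rightarrow> 'x::metric_space set \<Rightarrow> ('g \<Rightarrow> 'x \<Rightarrow> 'x) \<Rightarrow> ('x \<Rightarrow> 'y) \<Rightarrow> bool" where
  "rel_mean_sensitive n F X act \<pi> \<longleftrightarrow>
     (\<exists>\<epsilon>::real. \<epsilon> > 0 \<and>
       (\<forall>U. openin (top_of_set X) U \<and> U \<noteq> {} \<longrightarrow>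
         (\<exists>x :: nat \<Rightarrow> 'x.
            inj_on x {1..n} \<and> x ` {1..n} \<subseteq> U \<and>
            (\<forall>i\<in>{1..n}. \<forall>j\<in>{1..n}. \<pi> (x i) = \<pi> (x j)) \<and>
            limsup (\<lambda>m. ereal
              ((\<Sum>g\<in>F m. Min {dist (act g (x i)) (act g (x j)) | i j.
                                 i \<in> {1..n} \<and> j \<in> {1..n} \<and> i \<noteq> j})
                / real (card (F m)))) > ereal \<epsilon>)))"

end

theory Submission
  imports Defs
begin

text \<open>The argument is combinatorial: it uses no invariant measure and no convergence theorem
for entropy along Folner sequences.

If the averages defining the entropy of a cover tended to \<open>0\<close>, their limit would be \<open>0\<close>; so
positive entropy gives a cover \<open>\<U>\<close> and \<open>c > 0\<close> such that for infinitely many \<open>m\<close> some fibre needs at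
least \<open>exp (c |F m|)\<close> sets of the join of \<open>\<U>\<close> over \<open>F m\<close>. A Sauer--Shelah lemma for partially
defined binary patterns (\<open>partial_sauer\<close>) then yields disjoint compact sets \<open>A False\<close>, \<open>A True\<close> and
\<open>\<delta> > 0\<close> such that, for infinitely many \<open>m\<close>, some \<open>J \<subseteq> F m\<close> with \<open>|J| \<ge> \<delta> |F m|\<close> is independent in one
fibre: every \<open>\<omega> : J \<rightarrow> {False, True}\<close> is realised by a point \<open>x\<close> of the fibre with \<open>h x \<in> A (\<omega> h)\<close>
for all \<open>h \<in> J\<close>. This is \<open>positive_entropy_imp_independent_pair\<close>.

A pigeonhole argument (\<open>disjoint_popular_pattern\<close>) finds an \<open>n\<close>-element set \<open>S\<close> and many pairwise
disjoint translates \<open>S h \<subseteq> J\<close>. Prescribing which element of \<open>S\<close> is sent into \<open>A True\<close> turns the pair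
into \<open>n\<close> pairwise disjoint compact sets \<open>B 0, ..., B (n - 1)\<close> that have independent subsets of \<open>F m\<close>
of positive density for infinitely many \<open>m\<close>.

These finite sets are replaced by a single infinite one. Families of independent sets are
closed under subsets and right translations, so averaging over translates shows that every
convex combination of the densities \<open>H \<mapsto> |H \<inter> F m| / |F m|\<close> is somewhere large. A version of
Simons' inequality (\<open>simons_limsup\<close>) on the compact space of subsets of the group turns this
into one set \<open>H\<close> of positive upper density (\<open>infinite_set_of_positive_upper_density\<close>), and
compactness makes \<open>H\<close> independent in one fibre.

Finally, cut \<open>H\<close> into blocks, the \<open>k\<close>-th being most of \<open>H \<inter> F (m k)\<close>, and attach to each block a
finite list of natural numbers so that every list occurs infinitely often. Independence
provides points \<open>x i\<close> of one fibre, indexed by all natural numbers, such that on a block with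
list \<open>l\<close> the point \<open>x (l ! a)\<close> visits \<open>B a\<close>. Given a nonempty open \<open>U\<close>, minimality and compactness
give finitely many group elements such that every point is moved into \<open>U\<close> by one of them; hence
one element \<open>g\<close> moves infinitely many \<open>x i\<close> into \<open>U\<close>. Any \<open>n\<close> of these are the entries of some list \<open>l\<close>,
their translates by \<open>g\<close> lie in \<open>U\<close>, and they are uniformly separated along the infinitely many
blocks with list \<open>l\<close>. The separation and the density do not depend on \<open>U\<close>.\<close>

section \<open>Simons' inequality on a compact space\<close>

text \<open>\<open>tail_mean f k\<close> holds of the functions generated from the tail \<open>f k, f (k + 1), ...\<close> by
taking midpoints; these are the convex combinations with dyadic weights, which are all that is
needed below.\<close>
inductive tail_mean :: "(nat \<Rightarrow> 'a \<Rightarrow> real) \<Rightarrow> nat \<Rightarrow> ('a \<Rightarrow> real) \<Rightarrow> bool"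
  for f :: "nat \<Rightarrow> 'a \<Rightarrow> real" and k :: nat where
  member: "k \<le> m \<Longrightarrow> tail_mean f k (f m)"
| midpoint: "tail_mean f k u \<Longrightarrow> tail_mean f k v \<Longrightarrow> tail_mean f k (\<lambda>z. (u z + v z) / 2)"

lemma tail_mean_antimono:
  assumes "tail_mean f l u" "k \<le> l"
  shows "tail_mean f k u"
  using assms by induction (auto intro: tail_mean.intros order_trans)

lemma tail_mean_bounds:
  assumes "tail_mean f k u" and "\<And>m. k \<le> m \<Longrightarrow> a \<le> f m z \<and> f m z \<le> b"
  shows "a \<le> u z \<and> u z \<le> b"
  using assms by induction (auto simp: field_simps)

lemma tail_mean_continuous:
  assumes "tail_mean f k u" and "\<And>m. continuous_on Z (f m)"
  shows "continuous_on Z u"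
  using assms(1) by induction (auto intro!: continuous_intros assms(2))

text \<open>A form of Simons' inequality. On a compact space, if each dyadic convex combination of
continuous functions \<open>f m\<close> with values in \<open>[0, 1]\<close> is at least \<open>\<delta>\<close> somewhere, then at some point the
sequence \<open>f m\<close> itself is infinitely often at least \<open>\<delta> - \<eta>\<close>. Choose \<open>g k\<close> among the tail means so as
to almost minimise the supremum of \<open>S k + g k / 2 ^ k\<close>, where \<open>S k = (\<Sum>j<k. g j / 2 ^ Suc j)\<close>. At
a maximum point of the limit \<open>h\<close> of the \<open>S k\<close>, minimality forces every remainder \<open>h - S k\<close> to be at
least \<open>(\<delta> - \<eta> / 2) / 2 ^ k\<close>, so that no tail of the sequence can be uniformly smaller than
\<open>\<delta> - \<eta>\<close>.\<close>
lemma simons_limsup: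
  fixes Z :: "'a::topological_space set" and f :: "nat \<Rightarrow> 'a \<Rightarrow> real"
  assumes Z: "compact Z" "Z \<noteq> {}"
    and cont: "\<And>m. continuous_on Z (f m)"
    and bounds: "\<And>m z. z \<in> Z \<Longrightarrow> 0 \<le> f m z \<and> f m z \<le> 1"
    and lower: "\<And>u. tail_mean f 0 u \<Longrightarrow> \<exists>z\<in>Z. \<delta> \<le> u z"
    and \<eta>: "\<eta> > 0"
  shows "\<exists>z\<in>Z. \<exists>\<^sub>F m in sequentially. \<delta> - \<eta> \<le> f m z"
proof -
  define good where "good S k u \<longleftrightarrow> tail_mean f k u \<and>
     (\<forall>v c. tail_mean f k v \<longrightarrow> (\<forall>z\<in>Z. S z + v z / 2 ^ k \<le> c) \<longrightarrow>
        (\<forall>z\<in>Z. S z + u z / 2 ^ k \<le> c + \<eta> / 4 ^ Suc k))"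
    for S :: "'a \<Rightarrow> real" and k u
  have tm01: "0 \<le> v z \<and> v z \<le> 1" if "tail_mean f k v" "z \<in> Z" for k v z
    by (rule tail_mean_bounds[OF that(1)]) (use bounds that(2) in blast)
  have good_ex: "\<exists>u. good S k u" if S: "\<And>z. z \<in> Z \<Longrightarrow> 0 \<le> S z \<and> S z \<le> 1" for S k
  proof -
    define A where "A = {c. \<exists>v. tail_mean f k v \<and> (\<forall>z\<in>Z. S z + v z / 2 ^ k \<le> c)}"
    have "S z + f k z / 2 ^ k \<le> 2" if "z \<in> Z" for z
    proof -
      have "f k z / 2 ^ k \<le> 1"
        using bounds[OF that, of k] by (simp add: divide_le_eq order_trans[OF _ one_le_power])
      then show ?thesis using S[OF that] by linarith
    qed
    then have A_ne: "A \<noteq> {}"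
      unfolding A_def using tail_mean.member[of k k f] by blast
    obtain z0 where z0: "z0 \<in> Z" using Z by blast
    have A_bdd: "bdd_below A"
    proof (rule bdd_belowI)
      fix c assume "c \<in> A"
      then obtain v where v: "tail_mean f k v" "S z0 + v z0 / 2 ^ k \<le> c"
        unfolding A_def using z0 by blast
      have "0 \<le> v z0 / 2 ^ k" using tm01[OF v(1) z0] by simp
      then show "0 \<le> c" using v(2) S[OF z0] by linarith
    qed
    have "Inf A < Inf A + \<eta> / 4 ^ Suc k" using \<eta> by simp
    then obtain c where c: "c \<in> A" "c < Inf A + \<eta> / 4 ^ Suc k"
      using cInf_lessD[OF A_ne] by blast
    then obtain u where u: "tail_mean f k u" "\<forall>z\<in>Z. S z + u z / 2 ^ k \<le> c"
      unfolding A_def by blast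
    have "good S k u"
      unfolding good_def
    proof (intro conjI allI impI ballI u(1))
      fix v d z
      assume "tail_mean f k v" "\<forall>z\<in>Z. S z + v z / 2 ^ k \<le> d" "z \<in> Z"
      then have "d \<in> A" unfolding A_def by blast
      then have "Inf A \<le> d" using A_bdd by (rule cInf_lower)
      then show "S z + u z / 2 ^ k \<le> d + \<eta> / 4 ^ Suc k"
        using u(2) \<open>z \<in> Z\<close> c(2) by force
    qed
    then show ?thesis by blast
  qed
  define S where "S = rec_nat (\<lambda>z. 0) (\<lambda>k s z. s z + (SOME u. good s k u) z / 2 ^ Suc k)"
  define g where "g k = (SOME u. good (S k) k u)" for k
  have S0: "S 0 = (\<lambda>z. 0)" and S_Suc: "\<And>k. S (Suc k) = (\<lambda>z. S k z + g k z / 2 ^ Suc k)"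
    by (auto simp: S_def g_def)
  have S_bounds: "0 \<le> S k z \<and> S k z \<le> 1 - 1 / 2 ^ k" if "z \<in> Z" for k z
    using that
  proof (induction k arbitrary: z)
    case (Suc k)
    have "\<exists>u. good (S k) k u"
      by (rule good_ex) (use Suc.IH in \<open>smt (verit) divide_nonneg_nonneg zero_le_power\<close>)
    then have "good (S k) k (g k)" unfolding g_def by (rule someI_ex)
    then have "tail_mean f k (g k)" unfolding good_def by blast
    then have "0 \<le> g k z \<and> g k z \<le> 1" using tm01 Suc.prems by blast
    then have "0 \<le> g k z / 2 ^ Suc k \<and> g k z / 2 ^ Suc k \<le> 1 / 2 ^ Suc k"
      by (auto simp: divide_simps)
    then show ?case using Suc.IH[OF Suc.prems] unfolding S_Suc by simp
  qed (simp add: S0)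
  have good_g: "good (S k) k (g k)" for k
  proof -
    have "\<exists>u. good (S k) k u"
      by (rule good_ex) (use S_bounds[of _ k] in \<open>smt (verit) divide_nonneg_nonneg zero_le_power\<close>)
    then show ?thesis unfolding g_def by (rule someI_ex)
  qed
  have tm_g: "tail_mean f k (g k)" for k using good_g unfolding good_def by blast
  have g01: "0 \<le> g k z \<and> g k z \<le> 1" if "z \<in> Z" for k z
    using tm01[OF tm_g that] .
  have S_sum: "S k z = (\<Sum>j<k. g j z / 2 ^ Suc j)" for k z
    by (induction k) (auto simp: S0 S_Suc)
  have half_sums: "(\<lambda>j. (1 / 2 :: real) ^ Suc j) sums 1"
    using power_half_series .
  have g_summable: "summable (\<lambda>j. g j z / 2 ^ Suc j)" if "z \<in> Z" for z
    by (rule summable_comparison_test'[OF sums_summable[OF half_sums], of 0])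
      (use g01[OF that] in \<open>auto simp: power_divide divide_simps\<close>)
  define h where "h z = (\<Sum>j. g j z / 2 ^ Suc j)" for z
  have S_le_h: "S k z \<le> h z" if "z \<in> Z" for k z
    unfolding S_sum h_def by (rule sum_le_suminf[OF g_summable[OF that]]) (use g01[OF that] in auto)
  have "uniform_limit Z (\<lambda>n z. \<Sum>j<n. g j z / 2 ^ Suc j) h sequentially"
    unfolding h_def
    by (rule Weierstrass_m_test[OF _ sums_summable[OF half_sums]])
      (use g01 in \<open>auto simp: power_divide divide_simps\<close>)
  then have "continuous_on Z h"
    by (rule uniform_limit_theorem[rotated])
      (auto intro!: always_eventually continuous_intros tail_mean_continuous[OF tm_g cont])
  then obtain z where z: "z \<in> Z" "\<And>y. y \<in> Z \<Longrightarrow> h y \<le> h z"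
    using continuous_attains_sup[OF Z] by blast
  \<comment> \<open>the dyadic tail after \<open>k\<close>, closed up at \<open>K\<close> by repeating \<open>g K\<close>, competes with \<open>g k\<close>\<close>
  have tail: "\<exists>w. tail_mean f k w \<and> (\<forall>y. S k y + w y / 2 ^ k = S K y + g K y / 2 ^ K)"
    if "k \<le> K" for k K
    using that
  proof (induction rule: inc_induct)
    case base
    then show ?case using tm_g by blast
  next
    case (step k)
    then obtain w where w: "tail_mean f (Suc k) w"
      "\<And>y. S (Suc k) y + w y / 2 ^ Suc k = S K y + g K y / 2 ^ K" by blast
    have "tail_mean f k (\<lambda>z. (g k z + w z) / 2)"
      by (intro tail_mean.midpoint tm_g tail_mean_antimono[OF w(1)]) simp
    moreover have "S k y + (g k y + w y) / 2 / 2 ^ k = S K y + g K y / 2 ^ K" for y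
      using w(2)[of y] by (simp add: S_Suc field_simps)
    ultimately show ?case by blast
  qed
  have R_le: "S K y + g K y / 2 ^ K \<le> h z + (1 / 2) ^ K" if "y \<in> Z" for K y
  proof -
    have "g K y / 2 ^ K \<le> (1 / 2) ^ K" using g01[OF that, of K] by (simp add: power_divide divide_simps)
    then show ?thesis using S_le_h[OF that, of K] z(2)[OF that] by linarith
  qed
  have lim: "(\<lambda>K. h z + (1 / 2) ^ K) \<longlonglongrightarrow> h z + 0"
    by (intro tendsto_intros LIMSEQ_power_zero) auto
  have h_ge: "\<delta> \<le> h z"
  proof -
    have "\<delta> \<le> h z + (1 / 2) ^ K" for K
    proof -
      obtain w where w: "tail_mean f 0 w" "\<And>y. S 0 y + w y / 2 ^ 0 = S K y + g K y / 2 ^ K"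
        using tail[of 0 K] by blast
      obtain y where "y \<in> Z" "\<delta> \<le> w y" using lower[OF w(1)] by blast
      then show ?thesis using w(2)[of y] R_le[of y K] by (simp add: S0)
    qed
    then show ?thesis using LIMSEQ_le_const[OF lim] by auto
  qed
  \<comment> \<open>near-minimality of \<open>g k\<close> against the tails, as \<open>K\<close> tends to infinity\<close>
  have step: "S k z + g k z / 2 ^ k \<le> h z + \<eta> / 4 ^ Suc k" for k
  proof -
    have "S k z + g k z / 2 ^ k - \<eta> / 4 ^ Suc k \<le> h z + (1 / 2) ^ K" if "k \<le> K" for K
    proof -
      obtain w where w: "tail_mean f k w" "\<And>y. S k y + w y / 2 ^ k = S K y + g K y / 2 ^ K"
        using tail[OF \<open>k \<le> K\<close>] by blast
      then have "\<forall>y\<in>Z. S k y + w y / 2 ^ k \<le> h z + (1 / 2) ^ K" using R_le by simp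
      then have "S k z + g k z / 2 ^ k \<le> h z + (1 / 2) ^ K + \<eta> / 4 ^ Suc k"
        using good_g[of k] w(1) z(1) unfolding good_def by blast
      then show ?thesis by linarith
    qed
    then have "S k z + g k z / 2 ^ k - \<eta> / 4 ^ Suc k \<le> h z + 0"
      using LIMSEQ_le_const[OF lim] by blast
    then show ?thesis by linarith
  qed
  have rest: "2 ^ k * (h z - S k z) \<ge> \<delta> - \<eta> / 2 * (1 - (1 / 2) ^ k)" for k
  proof (induction k)
    case (Suc k)
    have "2 ^ Suc k * (h z - S (Suc k) z) = 2 ^ k * (2 * h z - 2 * S k z - g k z / 2 ^ k)"
      by (simp add: S_Suc field_simps)
    also have "\<dots> \<ge> 2 ^ k * (h z - S k z - \<eta> / 4 ^ Suc k)"
      using step[of k] by (intro mult_left_mono) auto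
    also have "2 ^ k * (h z - S k z - \<eta> / 4 ^ Suc k)
        = 2 ^ k * (h z - S k z) - \<eta> / 4 * (1 / 2) ^ k"
      by (simp add: field_simps power_mult_distrib[symmetric])
    finally show ?case using Suc by (simp add: algebra_simps)
  qed (simp add: h_ge S0)
  have "\<exists>\<^sub>F m in sequentially. \<delta> - \<eta> \<le> f m z"
    unfolding frequently_sequentially
  proof (rule ccontr, clarsimp)
    fix k assume "\<forall>n\<ge>k. \<not> \<delta> - \<eta> \<le> f n z"
    then have small: "g j z \<le> \<delta> - \<eta>" if "k \<le> j" for j
      using tail_mean_bounds[OF tm_g[of j], of 0 z "\<delta> - \<eta>"] bounds[OF z(1)] that
      by (meson less_eq_real_def not_le order_trans)
    have "h z - S k z = (\<Sum>j. g (j + k) z / 2 ^ Suc (j + k))"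
      unfolding h_def S_sum using suminf_minus_initial_segment[OF g_summable[OF z(1)], of k] by simp
    also have "\<dots> \<le> (\<Sum>j. (\<delta> - \<eta>) / 2 ^ k * (1 / 2) ^ Suc j)"
    proof (rule suminf_le)
      show "summable (\<lambda>j. g (j + k) z / 2 ^ Suc (j + k))"
        using summable_ignore_initial_segment[OF g_summable[OF z(1)], of k] by simp
      show "summable (\<lambda>j. (\<delta> - \<eta>) / 2 ^ k * (1 / 2) ^ Suc j)"
        by (intro summable_mult sums_summable[OF half_sums])
      show "g (j + k) z / 2 ^ Suc (j + k) \<le> (\<delta> - \<eta>) / 2 ^ k * (1 / 2) ^ Suc j" for j
        using small[of "j + k"] by (simp add: power_add power_divide divide_simps)
    qed
    also have "\<dots> = (\<delta> - \<eta>) / 2 ^ k"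
      using sums_unique[OF sums_mult[OF half_sums, of "(\<delta> - \<eta>) / 2 ^ k"], symmetric]
      by (simp only: mult_1_right)
    finally have "2 ^ k * (h z - S k z) \<le> \<delta> - \<eta>" by (simp add: field_simps)
    moreover have "\<eta> / 2 * (1 - (1 / 2) ^ k) \<le> \<eta> / 2 * 1"
      using \<eta> by (intro mult_left_mono) auto
    ultimately show False using rest[of k] \<eta> by linarith
  qed
  then show ?thesis using z(1) by blast
qed

section \<open>Shattering by partial binary patterns\<close>

text \<open>A point \<open>x\<close> determines a partial binary pattern, with value \<open>v\<close> at \<open>s\<close> if \<open>x \<in> P v s\<close>, and
undefined at \<open>s\<close> if \<open>x\<close> lies in neither \<open>P True s\<close> nor \<open>P False s\<close>. The set \<open>J\<close> is shattered by \<open>E\<close> if all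
binary patterns on \<open>J\<close> come from points of \<open>E\<close>.\<close>
definition shatters :: "(bool \<Rightarrow> 's \<Rightarrow> 'x set) \<Rightarrow> 'x set \<Rightarrow> 's set \<Rightarrow> bool" where
  "shatters P E J \<longleftrightarrow> (\<forall>\<omega>. \<exists>x\<in>E. \<forall>s\<in>J. x \<in> P (\<omega> s) s)"

definition shattered_count :: "(bool \<Rightarrow> 's \<Rightarrow> 'x set) \<Rightarrow> 'x set \<Rightarrow> 's set \<Rightarrow> nat" where
  "shattered_count P E Z = card {J. J \<subseteq> Z \<and> shatters P E J}"

lemma shatters_mono: "shatters P E J \<Longrightarrow> E \<subseteq> E' \<Longrightarrow> shatters P E' J"
  unfolding shatters_def by blast

lemma shattered_count_mono:
  assumes "finite Z'" "E \<subseteq> E'" "Z \<subseteq> Z'"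
  shows "shattered_count P E Z \<le> shattered_count P E' Z'"
  unfolding shattered_count_def
proof (rule card_mono)
  show "finite {J. J \<subseteq> Z' \<and> shatters P E' J}" using assms(1) by auto
  show "{J. J \<subseteq> Z \<and> shatters P E J} \<subseteq> {J. J \<subseteq> Z' \<and> shatters P E' J}"
    using shatters_mono[OF _ assms(2)] assms(3) by blast
qed

text \<open>A set shattered by either part is shattered by \<open>E\<close>, and it may be enlarged by \<open>s\<close> if it is
shattered by both.\<close>
lemma shattered_count_split:
  assumes "finite Z" "s \<notin> Z"
  shows "shattered_count P (E \<inter> P True s) Z + shattered_count P (E \<inter> P False s) Z
    \<le> shattered_count P E (insert s Z)"
proof -
  define A where "A v = {J. J \<subseteq> Z \<and> shatters P (E \<inter> P v s) J}" for v
  have fin: "finite (A v)" for v unfolding A_def using assms by auto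
  have *: "shatters P E (insert s J)" if "J \<in> A True \<inter> A False" for J
    unfolding shatters_def
  proof
    fix \<omega>
    have "shatters P (E \<inter> P (\<omega> s) s) J" using that unfolding A_def by (cases "\<omega> s") auto
    then show "\<exists>x\<in>E. \<forall>s\<in>insert s J. x \<in> P (\<omega> s) s" unfolding shatters_def by blast
  qed
  have "card (A True) + card (A False) = card (A True \<union> A False) + card (A True \<inter> A False)"
    by (rule card_Un_Int) (use fin in auto)
  also have "card (A True \<inter> A False) = card (insert s ` (A True \<inter> A False))"
    by (rule card_image[symmetric], rule inj_onI)
      (use assms(2) in \<open>auto simp: A_def dest: insert_ident[THEN iffD1, rotated 2]\<close>)
  also have "card (A True \<union> A False) + card (insert s ` (A True \<inter> A False))
      = card ((A True \<union> A False) \<union> insert s ` (A True \<inter> A False))"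
    by (rule card_Un_disjoint[symmetric]) (use fin assms in \<open>auto simp: A_def\<close>)
  also have "\<dots> \<le> card {J. J \<subseteq> insert s Z \<and> shatters P E J}"
  proof (rule card_mono)
    show "finite {J. J \<subseteq> insert s Z \<and> shatters P E J}" using assms by auto
    show "(A True \<union> A False) \<union> insert s ` (A True \<inter> A False)
        \<subseteq> {J. J \<subseteq> insert s Z \<and> shatters P E J}"
      using * shatters_mono[of P _ _ E] unfolding A_def by auto
  qed
  finally show ?thesis unfolding shattered_count_def A_def .
qed

text \<open>A Sauer--Shelah lemma for partial patterns: few total patterns \<open>\<sigma>\<close> suffice for each point
of \<open>E\<close> to agree with one of them wherever its own pattern is defined. By induction on \<open>Z\<close>, split \<open>E\<close>
at a new coordinate \<open>s\<close> into the points with the minority value \<open>v\<close> and the others, where points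
undefined at \<open>s\<close> count among the others. The minority part shatters at most half as many sets,
which accounts for the factor \<open>1 + (1 / 2) ^ \<beta>\<close>.\<close>
lemma partial_sauer:
  fixes P :: "bool \<Rightarrow> 's \<Rightarrow> 'x set" and \<beta> :: nat
  assumes "finite Z" and disj: "\<And>s. s \<in> Z \<Longrightarrow> P True s \<inter> P False s = {}"
  shows "\<exists>\<Sigma>. finite \<Sigma> \<and> (\<forall>x\<in>E. \<exists>\<sigma>\<in>\<Sigma>. \<forall>s\<in>Z. x \<notin> P (\<not> \<sigma> s) s) \<and>
    real (card \<Sigma>) \<le> real (shattered_count P E Z) ^ \<beta> * (1 + (1 / 2) ^ \<beta>) ^ card Z"
  using assms
proof (induction Z arbitrary: E rule: finite_induct)
  case empty
  show ?case
  proof (cases "E = {}")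
    case False
    then have "{J. J \<subseteq> {} \<and> shatters P E J} = {{}}" unfolding shatters_def by auto
    then have "shattered_count P E {} = 1" unfolding shattered_count_def by simp
    then show ?thesis by (intro exI[of _ "{\<lambda>_. True}"]) auto
  qed (intro exI[of _ "{}"], auto)
next
  case (insert s Z)
  define n where "n E = shattered_count P E Z" for E
  define N where "N = shattered_count P E (insert s Z)"
  have split: "n (E \<inter> P True s) + n (E \<inter> P False s) \<le> N"
    unfolding n_def N_def by (rule shattered_count_split[OF insert(1,2)])
  obtain v where v: "2 * n (E \<inter> P v s) \<le> N"
  proof (cases "2 * n (E \<inter> P True s) \<le> N")
    case False
    then show ?thesis using split that[of False] by linarith
  qed (use that in blast)
  have disj: "P True t \<inter> P False t = {}" if "t \<in> Z" for t using insert.prems that by blast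
  obtain \<Sigma>1 where \<Sigma>1: "finite \<Sigma>1" "\<forall>x\<in>E \<inter> P v s. \<exists>\<sigma>\<in>\<Sigma>1. \<forall>s\<in>Z. x \<notin> P (\<not> \<sigma> s) s"
    "real (card \<Sigma>1) \<le> real (n (E \<inter> P v s)) ^ \<beta> * (1 + (1 / 2) ^ \<beta>) ^ card Z"
    using insert.IH[OF disj, of "E \<inter> P v s"] unfolding n_def by blast
  obtain \<Sigma>2 where \<Sigma>2: "finite \<Sigma>2" "\<forall>x\<in>E - P v s. \<exists>\<sigma>\<in>\<Sigma>2. \<forall>s\<in>Z. x \<notin> P (\<not> \<sigma> s) s"
    "real (card \<Sigma>2) \<le> real (n (E - P v s)) ^ \<beta> * (1 + (1 / 2) ^ \<beta>) ^ card Z"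
    using insert.IH[OF disj, of "E - P v s"] unfolding n_def by blast
  define \<Sigma> where "\<Sigma> = (\<lambda>\<sigma>. \<sigma>(s := v)) ` \<Sigma>1 \<union> (\<lambda>\<sigma>. \<sigma>(s := \<not> v)) ` \<Sigma>2"
  have "finite \<Sigma>" unfolding \<Sigma>_def using \<Sigma>1(1) \<Sigma>2(1) by simp
  moreover have "\<exists>\<sigma>\<in>\<Sigma>. \<forall>t\<in>insert s Z. x \<notin> P (\<not> \<sigma> t) t" if xE: "x \<in> E" for x
  proof (cases "x \<in> P v s")
    case True
    then obtain \<sigma> where \<sigma>: "\<sigma> \<in> \<Sigma>1" "\<forall>t\<in>Z. x \<notin> P (\<not> \<sigma> t) t"
      using bspec[OF \<Sigma>1(2), of x] xE by auto
    have "x \<notin> P (\<not> v) s" using True insert.prems[of s] by (cases v) auto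
    then have "\<forall>t\<in>insert s Z. x \<notin> P (\<not> (\<sigma>(s := v)) t) t"
      using \<sigma>(2) insert(2) by (auto simp: fun_upd_def)
    moreover have "\<sigma>(s := v) \<in> \<Sigma>" unfolding \<Sigma>_def using \<sigma>(1) by simp
    ultimately show ?thesis by (rule bexI)
  next
    case False
    then obtain \<sigma> where \<sigma>: "\<sigma> \<in> \<Sigma>2" "\<forall>t\<in>Z. x \<notin> P (\<not> \<sigma> t) t"
      using bspec[OF \<Sigma>2(2), of x] xE by auto
    then have "\<forall>t\<in>insert s Z. x \<notin> P (\<not> (\<sigma>(s := \<not> v)) t) t"
      using False insert(2) by (auto simp: fun_upd_def)
    moreover have "\<sigma>(s := \<not> v) \<in> \<Sigma>" unfolding \<Sigma>_def using \<sigma>(1) by simp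
    ultimately show ?thesis by (rule bexI)
  qed
  moreover have "real (card \<Sigma>) \<le> real N ^ \<beta> * (1 + (1 / 2) ^ \<beta>) ^ card (insert s Z)"
  proof -
    define q :: real where "q = (1 + (1 / 2) ^ \<beta>) ^ card Z"
    have q: "q \<ge> 0" unfolding q_def by simp
    have "card \<Sigma> \<le> card \<Sigma>1 + card \<Sigma>2"
      unfolding \<Sigma>_def
      by (rule order_trans[OF card_Un_le add_mono[OF card_image_le card_image_le]])
        (use \<Sigma>1(1) \<Sigma>2(1) in auto)
    then have "real (card \<Sigma>) \<le> real (n (E \<inter> P v s)) ^ \<beta> * q + real (n (E - P v s)) ^ \<beta> * q"
      using \<Sigma>1(3) \<Sigma>2(3) unfolding q_def by linarith
    also have "\<dots> \<le> (real N / 2) ^ \<beta> * q + real N ^ \<beta> * q"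
    proof (intro add_mono mult_right_mono power_mono q)
      show "real (n (E \<inter> P v s)) \<le> real N / 2" using v by linarith
      have "n (E - P v s) \<le> N" unfolding n_def N_def
        by (rule shattered_count_mono) (use insert(1) in auto)
      then show "real (n (E - P v s)) \<le> real N" by simp
    qed auto
    also have "\<dots> = real N ^ \<beta> * (1 + (1 / 2) ^ \<beta>) ^ card (insert s Z)"
      using insert(1,2) by (simp add: q_def power_divide algebra_simps)
    finally show ?thesis .
  qed
  ultimately show ?case unfolding N_def by blast
qed

lemma card_small_subsets_le:
  fixes Z :: "'s set" and \<gamma> :: nat and d :: real
  assumes "finite Z"
  shows "real (card {J. J \<subseteq> Z \<and> real (card J) \<le> d})
    \<le> 2 powr (real \<gamma> * d) * (1 + (1 / 2) ^ \<gamma>) ^ card Z"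
proof -
  let ?A = "{J. J \<subseteq> Z \<and> real (card J) \<le> d}"
  have "real (card ?A) = (\<Sum>J\<in>?A. 1)" by simp
  also have "\<dots> \<le> (\<Sum>J\<in>?A. 2 powr (real \<gamma> * d) * ((1 / 2) ^ \<gamma>) ^ card J)"
  proof (rule sum_mono)
    fix J assume J: "J \<in> ?A"
    have "((1 / 2 :: real) ^ \<gamma>) ^ card J = 1 / 2 ^ (\<gamma> * card J)"
      by (simp only: power_mult power_one_over)
    also have "\<dots> = 1 / 2 powr (real \<gamma> * real (card J))"
      using powr_realpow[of 2 "\<gamma> * card J"] by simp
    finally have "2 powr (real \<gamma> * d) * ((1 / 2) ^ \<gamma>) ^ card J
        = 2 powr (real \<gamma> * d - real \<gamma> * real (card J))"
      by (simp only: powr_diff mult_1_right times_divide_eq_right)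
    moreover have "real \<gamma> * real (card J) \<le> real \<gamma> * d"
      using J by (intro mult_left_mono) auto
    ultimately show "1 \<le> 2 powr (real \<gamma> * d) * ((1 / 2) ^ \<gamma>) ^ card J"
      using ge_one_powr_ge_zero[of 2 "real \<gamma> * d - real \<gamma> * real (card J)"] by simp
  qed
  also have "\<dots> \<le> (\<Sum>J\<in>Pow Z. 2 powr (real \<gamma> * d) * ((1 / 2) ^ \<gamma>) ^ card J)"
    by (rule sum_mono2) (use assms in auto)
  also have "\<dots> = 2 powr (real \<gamma> * d) * (\<Sum>J\<in>Pow Z. (\<Prod>j\<in>J. (1 / 2) ^ \<gamma>) * (\<Prod>j\<in>Z - J. 1))"
    by (simp add: sum_distrib_left)
  also have "(\<Sum>J\<in>Pow Z. (\<Prod>j\<in>J. (1 / 2 :: real) ^ \<gamma>) * (\<Prod>j\<in>Z - J. 1)) = (1 + (1 / 2) ^ \<gamma>) ^ card Z"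
    using prod_add[OF assms, of "\<lambda>_. (1 / 2 :: real) ^ \<gamma>" "\<lambda>_. 1"] by (simp add: add.commute)
  finally show ?thesis .
qed

section \<open>Folner sequences and sets of positive density\<close>

text \<open>A group with a fixed two-sided Folner sequence.\<close>
locale folner_group = group G for G (structure) +
  fixes F :: "nat \<Rightarrow> 'a set"
  assumes folner: "folner_sequence G F"
begin

lemma F_finite [simp]: "finite (F m)" and F_nonempty [simp]: "F m \<noteq> {}"
  and F_carrier: "F m \<subseteq> carrier G"
  using folner unfolding folner_sequence_def by auto

lemma card_F_pos [simp]: "0 < card (F m)"
  by (simp add: card_gt_0_iff)

lemma eventually_card_image_diff_le:
  assumes g: "g \<in> carrier G" and "\<eta> > 0"
  shows "\<forall>\<^sub>F m in sequentially. real (card (F m - (\<lambda>h. g \<otimes> h) ` F m)) \<le> \<eta> * real (card (F m))"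
    and "\<forall>\<^sub>F m in sequentially. real (card (F m - (\<lambda>h. h \<otimes> g) ` F m)) \<le> \<eta> * real (card (F m))"
proof -
  have cosets: "g <# F m = (\<lambda>h. g \<otimes> h) ` F m" "F m #> g = (\<lambda>h. h \<otimes> g) ` F m" for m
    by (auto simp: l_coset_def r_coset_def)
  have *: "\<forall>\<^sub>F m in sequentially. real (card (F m - K m)) \<le> \<eta> * real (card (F m))"
    if lim: "(\<lambda>m. real (card (sym_diff (K m) (F m))) / real (card (F m))) \<longlonglongrightarrow> 0"
      and fin: "\<And>m. finite (K m)" for K :: "nat \<Rightarrow> 'a set"
    using order_tendstoD(2)[OF lim \<open>\<eta> > 0\<close>]
  proof eventually_elim
    case (elim m)
    have "card (F m - K m) \<le> card (sym_diff (K m) (F m))"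
      by (rule card_mono) (use fin in auto)
    then show ?case using elim by (simp add: divide_less_eq)
  qed
  have fin: "finite (g <# F m)" "finite (F m #> g)" for m
    by (simp_all add: cosets)
  have lim: "(\<lambda>m. real (card (sym_diff (g <# F m) (F m))) / real (card (F m))) \<longlonglongrightarrow> 0"
    "(\<lambda>m. real (card (sym_diff (F m #> g) (F m))) / real (card (F m))) \<longlonglongrightarrow> 0"
    using folner g unfolding folner_sequence_def by blast+
  show "\<forall>\<^sub>F m in sequentially. real (card (F m - (\<lambda>h. g \<otimes> h) ` F m)) \<le> \<eta> * real (card (F m))"
    "\<forall>\<^sub>F m in sequentially. real (card (F m - (\<lambda>h. h \<otimes> g) ` F m)) \<le> \<eta> * real (card (F m))"
    using *[OF lim(1) fin(1)] *[OF lim(2) fin(2)] unfolding cosets by blast+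
qed

lemma card_translate_ge:
  assumes inj: "inj_on \<tau> (F m)" and A: "A \<subseteq> F m"
    and small: "real (card (F m - \<tau> ` F m)) \<le> \<eta> * real (card (F m))"
  shows "real (card A) - \<eta> * real (card (F m)) \<le> real (card {h \<in> F m. \<tau> h \<in> A})"
proof -
  have "card A \<le> card (\<tau> ` {h \<in> F m. \<tau> h \<in> A} \<union> (F m - \<tau> ` F m))"
    by (rule card_mono) (use A in auto)
  also have "\<dots> \<le> card (\<tau> ` {h \<in> F m. \<tau> h \<in> A}) + card (F m - \<tau> ` F m)"
    by (rule card_Un_le)
  also have "card (\<tau> ` {h \<in> F m. \<tau> h \<in> A}) = card {h \<in> F m. \<tau> h \<in> A}"
    by (rule card_image) (use inj in \<open>auto intro: inj_on_subset\<close>)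
  finally show ?thesis using small by linarith
qed

lemma eventually_left_translate:
  assumes "g \<in> carrier G" "\<eta> > 0"
  shows "\<forall>\<^sub>F m in sequentially. \<forall>A\<subseteq>F m.
    real (card A) - \<eta> * real (card (F m)) \<le> real (card {h \<in> F m. g \<otimes> h \<in> A})"
  using eventually_card_image_diff_le(1)[OF assms]
proof eventually_elim
  case (elim m)
  have "inj_on (\<lambda>h. g \<otimes> h) (F m)"
    by (rule inj_onI) (use assms(1) F_carrier[of m] in \<open>simp add: subset_iff\<close>)
  then show ?case using card_translate_ge elim by blast
qed

lemma eventually_right_translate:
  assumes "g \<in> carrier G" "\<eta> > 0"
  shows "\<forall>\<^sub>F m in sequentially. \<forall>A\<subseteq>F m.
    real (card A) - \<eta> * real (card (F m)) \<le> real (card {h \<in> F m. h \<otimes> g \<in> A})"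
  using eventually_card_image_diff_le(2)[OF assms]
proof eventually_elim
  case (elim m)
  have "inj_on (\<lambda>h. h \<otimes> g) (F m)"
    by (rule inj_onI) (use assms(1) F_carrier[of m] in \<open>simp add: subset_iff\<close>)
  then show ?case using card_translate_ge elim by blast
qed

text \<open>A set of bounded size that is almost invariant under many translations is exactly
invariant under them, and hence contains the translates of each of its points by their
inverses.\<close>
lemma card_F_at_top:
  assumes "infinite (carrier G)"
  shows "\<forall>\<^sub>F m in sequentially. C \<le> card (F m)"
proof -
  obtain T where T: "T \<subseteq> carrier G" "finite T" "card T = C"
    using infinite_arbitrarily_large[OF assms] by blast
  have pos: "1 / (real C + 1) > 0" by simp
  have "\<forall>\<^sub>F m in sequentially. \<forall>g\<in>T.
      real (card (F m - (\<lambda>h. g \<otimes> h) ` F m)) \<le> 1 / (real C + 1) * real (card (F m))"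
    using T eventually_card_image_diff_le(1)[OF _ pos] by (intro eventually_ball_finite) auto
  then show ?thesis
  proof eventually_elim
    case (elim m)
    show ?case
    proof (rule ccontr)
      assume small: "\<not> C \<le> card (F m)"
      have sub: "F m \<subseteq> (\<lambda>h. g \<otimes> h) ` F m" if "g \<in> T" for g
      proof -
        have "real (card (F m - (\<lambda>h. g \<otimes> h) ` F m)) \<le> 1 / (real C + 1) * real (card (F m))"
          using elim that by blast
        also have "\<dots> < 1" using small by (simp add: divide_less_eq)
        finally show ?thesis by simp
      qed
      obtain f where f: "f \<in> F m" using F_nonempty by blast
      have "(\<lambda>g. inv g \<otimes> f) ` T \<subseteq> F m"
      proof (rule image_subsetI)
        fix g assume g: "g \<in> T"
        then obtain h where h: "h \<in> F m" "f = g \<otimes> h" using sub f by blast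
        have "g \<in> carrier G" "h \<in> carrier G" using g h(1) T(1) F_carrier by auto
        then have "inv g \<otimes> f = h" unfolding h(2) by (simp add: m_assoc[symmetric])
        then show "inv g \<otimes> f \<in> F m" using h(1) by simp
      qed
      moreover have "inj_on (\<lambda>g. inv g \<otimes> f) T"
      proof (rule inj_onI)
        fix g g' assume *: "g \<in> T" "g' \<in> T" "inv g \<otimes> f = inv g' \<otimes> f"
        have "g \<in> carrier G" "g' \<in> carrier G" "f \<in> carrier G" using * f T(1) F_carrier by auto
        then show "g = g'" using *(3) by (metis inv_closed inv_inv right_cancel)
      qed
      ultimately have "C \<le> card (F m)" using card_inj_on_le T(3) F_finite by blast
      then show False using small by simp
    qed
  qed
qed

end

text \<open>A graph in which closed neighbourhoods have at most \<open>d\<close> elements has an independent set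
containing at least one \<open>d\<close>-th of the vertices.\<close>
lemma independent_subset:
  fixes R :: "'b \<Rightarrow> 'b \<Rightarrow> bool"
  assumes "finite A" "\<And>a. a \<in> A \<Longrightarrow> R a a" "\<And>a b. R a b \<Longrightarrow> R b a"
    and "\<And>a. a \<in> A \<Longrightarrow> card {b \<in> A. R a b} \<le> d"
  shows "\<exists>B\<subseteq>A. (\<forall>a\<in>B. \<forall>b\<in>B. R a b \<longrightarrow> a = b) \<and> card A \<le> d * card B"
  using assms(1,2,4)
proof (induction "card A" arbitrary: A rule: less_induct)
  case less
  show ?case
  proof (cases "A = {}")
    case False
    then obtain a where a: "a \<in> A" by blast
    define A' where "A' = A - {b \<in> A. R a b}"
    have "card A' < card A"
      unfolding A'_def by (rule psubset_card_mono) (use less.prems a in auto)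
    moreover have "card {b \<in> A'. R x b} \<le> d" if "x \<in> A'" for x
    proof -
      have "card {b \<in> A'. R x b} \<le> card {b \<in> A. R x b}"
        by (rule card_mono) (use less.prems in \<open>auto simp: A'_def\<close>)
      then show ?thesis using less.prems(3)[of x] that by (simp add: A'_def)
    qed
    ultimately obtain B where B: "B \<subseteq> A'" "\<forall>a\<in>B. \<forall>b\<in>B. R a b \<longrightarrow> a = b" "card A' \<le> d * card B"
      using less.hyps[of A'] less.prems(1,2) unfolding A'_def by auto
    have finB: "finite B" using B(1) less.prems(1) unfolding A'_def by (meson finite_Diff finite_subset)
    have notin: "a \<notin> B" using B(1) less.prems(2) a unfolding A'_def by blast
    have "card A = card A' + card {b \<in> A. R a b}"
      unfolding A'_def using less.prems(1) by (subst card_Diff_subset) (auto intro!: le_add_diff_inverse2[symmetric] card_mono)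
    also have "\<dots> \<le> d * card B + d" using B(3) less.prems(3)[OF a] by linarith
    also have "\<dots> = d * card (insert a B)" using finB notin by simp
    finally have "card A \<le> d * card (insert a B)" .
    moreover have "\<forall>x\<in>insert a B. \<forall>y\<in>insert a B. R x y \<longrightarrow> x = y"
      using B(1,2) assms(3) unfolding A'_def by blast
    moreover have "insert a B \<subseteq> A" using B(1) a unfolding A'_def by blast
    ultimately show ?thesis by blast
  qed simp
qed

context folner_group
begin

text \<open>Inside a set \<open>J \<subseteq> F m\<close> of density \<open>\<delta>\<close>, translates of a large finite set \<open>T\<close> meet \<open>J\<close> in at least
\<open>n\<close> points for a positive proportion of translations, because \<open>F m\<close> is almost invariant. Since \<open>T\<close>
has only finitely many \<open>n\<close>-element subsets, one of them serves for a positive proportion, and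
for infinitely many \<open>m\<close>.\<close>
lemma popular_pattern:
  assumes inf: "infinite (carrier G)" and "\<delta> > 0" and "n \<ge> 1"
    and freq: "\<exists>\<^sub>F m in sequentially. \<exists>J\<subseteq>F m. Q J \<and> \<delta> * real (card (F m)) \<le> real (card J)"
  shows "\<exists>S \<epsilon>. S \<subseteq> carrier G \<and> finite S \<and> card S = n \<and> \<epsilon> > 0 \<and>
    (\<exists>\<^sub>F m in sequentially. \<exists>J\<subseteq>F m. Q J \<and>
       \<epsilon> * real (card (F m)) \<le> real (card {g \<in> F m. \<forall>s\<in>S. s \<otimes> g \<in> J}))"
proof -
  obtain K :: nat where K: "4 * real n / \<delta> < real K" using reals_Archimedean2 by blast
  have nK: "real n \<le> \<delta> / 4 * real K" using K \<open>\<delta> > 0\<close> by (simp add: field_simps)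
  have K0: "K > 0" using K \<open>\<delta> > 0\<close> by (cases K) (auto simp: field_simps)
  obtain T where T: "T \<subseteq> carrier G" "finite T" "card T = K"
    using infinite_arbitrarily_large[OF inf] by blast
  define \<S> where "\<S> = {S. S \<subseteq> T \<and> card S = n}"
  have fin\<S>: "finite \<S>" unfolding \<S>_def using T(2) by auto
  have card\<S>: "card \<S> \<le> 2 ^ K"
    using card_mono[of "Pow T" \<S>] T card_Pow[of T] unfolding \<S>_def by auto
  define \<epsilon> where "\<epsilon> = \<delta> / (2 * 2 ^ K)"
  have \<epsilon>: "\<epsilon> > 0" unfolding \<epsilon>_def using \<open>\<delta> > 0\<close> by simp
  have "\<forall>\<^sub>F m in sequentially. \<forall>t\<in>T. \<forall>A\<subseteq>F m.
      real (card A) - \<delta> / 4 * real (card (F m)) \<le> real (card {h \<in> F m. t \<otimes> h \<in> A})"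
    using T eventually_left_translate[where \<eta> = "\<delta> / 4"] \<open>\<delta> > 0\<close>
    by (intro eventually_ball_finite) auto
  from frequently_eventually_conj[OF freq this]
  have "\<exists>\<^sub>F m in sequentially. (\<exists>J\<subseteq>F m. Q J \<and> \<delta> * real (card (F m)) \<le> real (card J)) \<and>
    (\<forall>t\<in>T. \<forall>A\<subseteq>F m.
      real (card A) - \<delta> / 4 * real (card (F m)) \<le> real (card {h \<in> F m. t \<otimes> h \<in> A}))"
    by (simp add: conj_commute)
  then have "\<exists>\<^sub>F m in sequentially. \<exists>S\<in>\<S>. \<exists>J\<subseteq>F m. Q J \<and>
       \<epsilon> * real (card (F m)) \<le> real (card {g \<in> F m. \<forall>s\<in>S. s \<otimes> g \<in> J})"
  proof (rule frequently_elim1)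
    fix m
    define N where "N = real (card (F m))"
    assume "(\<exists>J\<subseteq>F m. Q J \<and> \<delta> * real (card (F m)) \<le> real (card J)) \<and>
      (\<forall>t\<in>T. \<forall>A\<subseteq>F m.
        real (card A) - \<delta> / 4 * real (card (F m)) \<le> real (card {h \<in> F m. t \<otimes> h \<in> A}))"
    then obtain J where J: "J \<subseteq> F m" "Q J" "\<delta> * N \<le> real (card J)"
      and tr: "\<And>t. t \<in> T \<Longrightarrow> real (card J) - \<delta> / 4 * N \<le> real (card {h \<in> F m. t \<otimes> h \<in> J})"
      unfolding N_def by blast
    define c where "c g = card {t \<in> T. t \<otimes> g \<in> J}" for g
    define good where "good = {g \<in> F m. n \<le> c g}"
    have c_le: "c g \<le> K" for g
      unfolding c_def T(3)[symmetric] by (rule card_mono) (use T in auto)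
    have "real K * (3 * \<delta> / 4 * N) = (\<Sum>t\<in>T. 3 * \<delta> / 4 * N)" using T by simp
    also have "\<dots> \<le> (\<Sum>t\<in>T. real (card {h \<in> F m. t \<otimes> h \<in> J}))"
    proof (rule sum_mono)
      fix t assume "t \<in> T"
      from tr[OF this] show "3 * \<delta> / 4 * N \<le> real (card {h \<in> F m. t \<otimes> h \<in> J})"
        using J(3) by (simp add: algebra_simps)
    qed
    also have "\<dots> = (\<Sum>t\<in>T. \<Sum>g\<in>F m. of_bool (t \<otimes> g \<in> J))"
      by (simp add: Int_def)
    also have "\<dots> = (\<Sum>g\<in>F m. \<Sum>t\<in>T. of_bool (t \<otimes> g \<in> J))"
      by (rule sum.swap)
    also have "\<dots> = (\<Sum>g\<in>F m. real (c g))"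
      using T(2) by (simp add: c_def Int_def)
    also have "\<dots> \<le> (\<Sum>g\<in>F m. real K * of_bool (g \<in> good) + real n)"
    proof (rule sum_mono)
      fix g assume "g \<in> F m"
      then show "real (c g) \<le> real K * of_bool (g \<in> good) + real n"
        using c_le[of g] by (cases "n \<le> c g") (simp_all add: good_def)
    qed
    also have "\<dots> = real K * real (card good) + N * real n"
      unfolding N_def sum.distrib sum_distrib_left[symmetric] good_def
      by (simp add: Int_def conj_commute)
    also have "\<dots> \<le> real K * real (card good) + N * (\<delta> / 4 * real K)"
      using nK by (intro add_left_mono mult_left_mono) (auto simp: N_def)
    finally have "real K * (\<delta> / 2 * N) \<le> real K * real (card good)"
      by (simp add: algebra_simps)
    then have good: "\<delta> / 2 * N \<le> real (card good)" using K0 by simp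
    have "good \<subseteq> (\<Union>S\<in>\<S>. {g \<in> F m. \<forall>s\<in>S. s \<otimes> g \<in> J})"
    proof
      fix g assume "g \<in> good"
      then have g: "g \<in> F m" "n \<le> card {t \<in> T. t \<otimes> g \<in> J}" unfolding good_def c_def by auto
      obtain S where "S \<subseteq> {t \<in> T. t \<otimes> g \<in> J}" "card S = n"
        using obtain_subset_with_card_n[OF g(2)] by blast
      then show "g \<in> (\<Union>S\<in>\<S>. {g \<in> F m. \<forall>s\<in>S. s \<otimes> g \<in> J})"
        using g(1) unfolding \<S>_def by blast
    qed
    then have "card good \<le> card (\<Union>S\<in>\<S>. {g \<in> F m. \<forall>s\<in>S. s \<otimes> g \<in> J})"
      by (intro card_mono) (use fin\<S> in auto)
    also have "\<dots> \<le> (\<Sum>S\<in>\<S>. card {g \<in> F m. \<forall>s\<in>S. s \<otimes> g \<in> J})"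
      by (rule card_UN_le[OF fin\<S>])
    finally have sum: "real (card good) \<le> (\<Sum>S\<in>\<S>. real (card {g \<in> F m. \<forall>s\<in>S. s \<otimes> g \<in> J}))"
      unfolding of_nat_sum[symmetric] of_nat_le_iff .
    have "\<exists>S\<in>\<S>. \<epsilon> * N \<le> real (card {g \<in> F m. \<forall>s\<in>S. s \<otimes> g \<in> J})"
    proof (rule ccontr)
      assume "\<not> ?thesis"
      then have less: "real (card {g \<in> F m. \<forall>s\<in>S. s \<otimes> g \<in> J}) < \<epsilon> * N" if "S \<in> \<S>" for S
        using that by auto
      have N: "N > 0" unfolding N_def by simp
      have "0 < \<delta> / 2 * N" using N \<open>\<delta> > 0\<close> by simp
      then have "real (card good) > 0" using good by linarith
      then have "\<S> \<noteq> {}" using sum by auto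
      then have "real (card good) < (\<Sum>S\<in>\<S>. \<epsilon> * N)"
        by (rule le_less_trans[OF sum sum_strict_mono[OF fin\<S> _ less]])
      also have "\<dots> \<le> 2 ^ K * (\<epsilon> * N)"
      proof -
        have "real (card \<S>) \<le> 2 ^ K" using card\<S> by (metis of_nat_le_iff of_nat_numeral of_nat_power)
        then have "real (card \<S>) * (\<epsilon> * N) \<le> 2 ^ K * (\<epsilon> * N)"
          using \<epsilon> N by (intro mult_right_mono) auto
        then show ?thesis by simp
      qed
      also have "\<dots> = \<delta> / 2 * N" unfolding \<epsilon>_def by simp
      finally show False using good by simp
    qed
    then show "\<exists>S\<in>\<S>. \<exists>J\<subseteq>F m. Q J \<and>
       \<epsilon> * real (card (F m)) \<le> real (card {g \<in> F m. \<forall>s\<in>S. s \<otimes> g \<in> J})"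
      using J(1,2) unfolding N_def by blast
  qed
  then have "\<exists>S\<in>\<S>. \<exists>\<^sub>F m in sequentially. \<exists>J\<subseteq>F m. Q J \<and>
       \<epsilon> * real (card (F m)) \<le> real (card {g \<in> F m. \<forall>s\<in>S. s \<otimes> g \<in> J})"
    by (rule frequently_bex_finite[OF fin\<S>])
  then obtain S where S: "S \<in> \<S>" "\<exists>\<^sub>F m in sequentially. \<exists>J\<subseteq>F m. Q J \<and>
       \<epsilon> * real (card (F m)) \<le> real (card {g \<in> F m. \<forall>s\<in>S. s \<otimes> g \<in> J})"
    by blast
  have "S \<subseteq> carrier G" "finite S" "card S = n"
    using S(1) T(1,2) finite_subset unfolding \<S>_def by auto
  then show ?thesis using S(2) \<epsilon> by blast
qed

text \<open>Two translates of an \<open>n\<close>-element set \<open>S\<close> meet for at most \<open>n * n\<close> choices of the second one, so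
the translates can be thinned out to become pairwise disjoint at the cost of a factor \<open>n * n\<close> in
density.\<close>
lemma disjoint_popular_pattern:
  assumes inf: "infinite (carrier G)" and "\<delta> > 0" and "n \<ge> 1"
    and freq: "\<exists>\<^sub>F m in sequentially. \<exists>J\<subseteq>F m. Q J \<and> \<delta> * real (card (F m)) \<le> real (card J)"
  shows "\<exists>S \<epsilon>. S \<subseteq> carrier G \<and> finite S \<and> card S = n \<and> \<epsilon> > 0 \<and>
    (\<exists>\<^sub>F m in sequentially. \<exists>J H. J \<subseteq> F m \<and> Q J \<and> H \<subseteq> F m \<and>
       (\<forall>s\<in>S. \<forall>h\<in>H. s \<otimes> h \<in> J) \<and>
       (\<forall>s\<in>S. \<forall>s'\<in>S. \<forall>h\<in>H. \<forall>h'\<in>H. s \<otimes> h = s' \<otimes> h' \<longrightarrow> h = h') \<and>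
       \<epsilon> * real (card (F m)) \<le> real (card H))"
proof -
  obtain S \<epsilon> where S: "S \<subseteq> carrier G" "finite S" "card S = n" and "\<epsilon> > 0"
    and freq: "\<exists>\<^sub>F m in sequentially. \<exists>J\<subseteq>F m. Q J \<and>
       \<epsilon> * real (card (F m)) \<le> real (card {g \<in> F m. \<forall>s\<in>S. s \<otimes> g \<in> J})"
    using popular_pattern[OF assms] by blast
  have n2: "real (n * n) > 0" using \<open>n \<ge> 1\<close> by simp
  have "S \<noteq> {}" using S(3) \<open>n \<ge> 1\<close> by auto
  define R where "R h h' \<longleftrightarrow> (\<exists>s\<in>S. \<exists>s'\<in>S. s \<otimes> h = s' \<otimes> h')" for h h'
  from freq have "\<exists>\<^sub>F m in sequentially. \<exists>J H. J \<subseteq> F m \<and> Q J \<and> H \<subseteq> F m \<and>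
       (\<forall>s\<in>S. \<forall>h\<in>H. s \<otimes> h \<in> J) \<and>
       (\<forall>s\<in>S. \<forall>s'\<in>S. \<forall>h\<in>H. \<forall>h'\<in>H. s \<otimes> h = s' \<otimes> h' \<longrightarrow> h = h') \<and>
       \<epsilon> / real (n * n) * real (card (F m)) \<le> real (card H)"
  proof (rule frequently_elim1)
    fix m
    assume "\<exists>J\<subseteq>F m. Q J \<and> \<epsilon> * real (card (F m)) \<le> real (card {g \<in> F m. \<forall>s\<in>S. s \<otimes> g \<in> J})"
    then obtain J where J: "J \<subseteq> F m" "Q J"
      "\<epsilon> * real (card (F m)) \<le> real (card {g \<in> F m. \<forall>s\<in>S. s \<otimes> g \<in> J})" by blast
    define A where "A = {g \<in> F m. \<forall>s\<in>S. s \<otimes> g \<in> J}"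
    have A: "A \<subseteq> carrier G" "finite A" unfolding A_def using F_carrier by auto
    have "\<exists>H\<subseteq>A. (\<forall>a\<in>H. \<forall>b\<in>H. R a b \<longrightarrow> a = b) \<and> card A \<le> (n * n) * card H"
    proof (rule independent_subset)
      show "R a a" for a unfolding R_def using \<open>S \<noteq> {}\<close> by blast
      show "R b a" if "R a b" for a b using that unfolding R_def by metis
      show "card {b \<in> A. R a b} \<le> n * n" if "a \<in> A" for a
      proof -
        have "{b \<in> A. R a b} \<subseteq> (\<lambda>(s, s'). inv s' \<otimes> (s \<otimes> a)) ` (S \<times> S)"
        proof
          fix b assume "b \<in> {b \<in> A. R a b}"
          then obtain s s' where *: "b \<in> A" "s \<in> S" "s' \<in> S" "s \<otimes> a = s' \<otimes> b"
            unfolding R_def by blast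
          then have "b = inv s' \<otimes> (s \<otimes> a)"
            using inv_solve_left'[of b s' "s \<otimes> a"] A(1) S(1) that by (auto simp: subset_iff)
          then show "b \<in> (\<lambda>(s, s'). inv s' \<otimes> (s \<otimes> a)) ` (S \<times> S)"
            using *(2,3) by (intro image_eqI[of _ _ "(s, s')"]) auto
        qed
        then have "card {b \<in> A. R a b} \<le> card (S \<times> S)"
          using S(2) by (intro surj_card_le) auto
        then show ?thesis using S(3) by (simp add: card_cartesian_product)
      qed
    qed (use A in auto)
    then obtain H where H: "H \<subseteq> A" "\<forall>a\<in>H. \<forall>b\<in>H. R a b \<longrightarrow> a = b" "card A \<le> (n * n) * card H"
      by blast
    have "\<epsilon> * real (card (F m)) \<le> real (n * n) * real (card H)"
    proof -
      have "real (card A) \<le> real (n * n) * real (card H)"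
        using of_nat_mono[OF H(3), where 'a = real] by (simp only: of_nat_mult)
      then show ?thesis using J(3) unfolding A_def by linarith
    qed
    then have 1: "\<epsilon> / real (n * n) * real (card (F m)) \<le> real (card H)"
      using n2 by (simp add: field_simps)
    have 2: "H \<subseteq> F m" "\<forall>s\<in>S. \<forall>h\<in>H. s \<otimes> h \<in> J" using H(1) unfolding A_def by auto
    have 3: "\<forall>s\<in>S. \<forall>s'\<in>S. \<forall>h\<in>H. \<forall>h'\<in>H. s \<otimes> h = s' \<otimes> h' \<longrightarrow> h = h'"
      using H(2) unfolding R_def by blast
    show "\<exists>J H. J \<subseteq> F m \<and> Q J \<and> H \<subseteq> F m \<and> (\<forall>s\<in>S. \<forall>h\<in>H. s \<otimes> h \<in> J) \<and>
       (\<forall>s\<in>S. \<forall>s'\<in>S. \<forall>h\<in>H. \<forall>h'\<in>H. s \<otimes> h = s' \<otimes> h' \<longrightarrow> h = h') \<and>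
       \<epsilon> / real (n * n) * real (card (F m)) \<le> real (card H)"
      by (rule exI[of _ J], rule exI[of _ H]) (intro conjI J 1 2 3)
  qed
  moreover have "\<epsilon> / real (n * n) > 0" using \<open>\<epsilon> > 0\<close> n2 by simp
  ultimately show ?thesis using S by blast
qed

text \<open>If a family of finite sets is closed under subsets and right translations and contains
subsets of \<open>F m\<close> of density \<open>\<delta>\<close> for infinitely many \<open>m\<close>, then some \<open>H\<close> of positive upper density has
all its finite subsets in the family. Subsets of the group are encoded by their characteristic
functions, which form a compact product space.\<close>
lemma infinite_set_of_positive_upper_density:
  assumes sub: "\<And>A B. P A \<Longrightarrow> B \<subseteq> A \<Longrightarrow> P B"
    and translate: "\<And>A g. P A \<Longrightarrow> g \<in> carrier G \<Longrightarrow> P {h \<in> carrier G. h \<otimes> g \<in> A}"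
    and "\<delta> > 0"
    and freq: "\<exists>\<^sub>F m in sequentially. \<exists>A\<subseteq>F m. P A \<and> \<delta> * real (card (F m)) \<le> real (card A)"
  shows "\<exists>H\<subseteq>carrier G. (\<forall>A. finite A \<longrightarrow> A \<subseteq> H \<longrightarrow> P A) \<and>
    (\<exists>\<^sub>F m in sequentially. \<delta> / 2 * real (card (F m)) \<le> real (card (H \<inter> F m)))"
proof -
  define Z where "Z = {\<xi> :: 'a \<Rightarrow> bool. \<forall>A. finite A \<longrightarrow> (\<forall>a\<in>A. \<xi> a) \<longrightarrow> A \<subseteq> carrier G \<and> P A}"
  define f where "f m \<xi> = (\<Sum>g\<in>F m. of_bool (\<xi> g)) / real (card (F m))" for m and \<xi> :: "'a \<Rightarrow> bool"
  have coord: "continuous_on UNIV (\<lambda>\<xi> :: 'a \<Rightarrow> bool. of_bool (\<xi> g) :: real)" for g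
  proof -
    have "continuous_on UNIV (of_bool :: bool \<Rightarrow> real)" by simp
    then have "continuous_on UNIV ((of_bool :: bool \<Rightarrow> real) \<circ> (\<lambda>\<xi>. \<xi> g))"
      by (intro continuous_on_compose continuous_on_product_coordinates)
        (rule continuous_on_subset, auto)
    then show ?thesis by (simp add: o_def)
  qed
  have "closed Z"
  proof -
    have "Z = (\<Inter>A\<in>{A. finite A \<and> \<not> (A \<subseteq> carrier G \<and> P A)}. \<Union>a\<in>A. {\<xi>. of_bool (\<xi> a) = (0::real)})"
      unfolding Z_def by auto
    also have "closed \<dots>"
      by (intro closed_INT closed_UN ballI closed_Collect_eq coord continuous_intros) auto
    finally show ?thesis .
  qed
  moreover have "compact (UNIV :: ('a \<Rightarrow> bool) set)"
  proof -
    have "compact (UNIV :: bool set)" by (rule finite_imp_compact) simp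
    then have "compactin (product_topology (\<lambda>_::'a. euclidean) UNIV) (PiE UNIV (\<lambda>_. UNIV :: bool set))"
      unfolding compactin_PiE by (simp only: compactin_euclidean_iff) simp
    then show ?thesis by (simp add: euclidean_product_topology PiE_UNIV_domain)
  qed
  ultimately have "compact Z" using compact_Int_closed[of UNIV Z] by simp
  define tr where "tr A g = (\<lambda>h. h \<in> carrier G \<and> h \<otimes> g \<in> A)" for A :: "'a set" and g
  have tr_Z: "tr A g \<in> Z" if "P A" "g \<in> carrier G" for A g
    unfolding Z_def tr_def using sub[OF translate[OF that]] by (auto simp: subset_eq)
  \<comment> \<open>averaged over translates of \<open>A\<close>, every tail mean of the densities recovers the density of \<open>A\<close>\<close>
  have average: "\<forall>\<^sub>F M in sequentially. \<forall>A\<subseteq>F M.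
      real (card A) - \<eta> * real (card (F M)) \<le> (\<Sum>g\<in>F M. u (tr A g))"
    if "tail_mean f 0 u" "\<eta> > 0" for u \<eta>
    using that(1)
  proof induction
    case (member m)
    have "\<forall>\<^sub>F M in sequentially. \<forall>h\<in>F m. \<forall>A\<subseteq>F M.
        real (card A) - \<eta> * real (card (F M)) \<le> real (card {g \<in> F M. h \<otimes> g \<in> A})"
    proof (rule eventually_ball_finite[OF F_finite], rule ballI)
      fix h assume "h \<in> F m"
      then show "\<forall>\<^sub>F M in sequentially. \<forall>A\<subseteq>F M.
          real (card A) - \<eta> * real (card (F M)) \<le> real (card {g \<in> F M. h \<otimes> g \<in> A})"
        by (intro eventually_left_translate subsetD[OF F_carrier[of m]] \<open>\<eta> > 0\<close>)
    qed
    then show ?case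
    proof eventually_elim
      case (elim M)
      show ?case
      proof (intro allI impI)
        fix A assume A: "A \<subseteq> F M"
        have "real (card A) - \<eta> * real (card (F M))
            = (\<Sum>h\<in>F m. real (card A) - \<eta> * real (card (F M))) / real (card (F m))" by simp
        also have "\<dots> \<le> (\<Sum>h\<in>F m. real (card {g \<in> F M. h \<otimes> g \<in> A})) / real (card (F m))"
          using elim A by (intro divide_right_mono sum_mono) auto
        also have "(\<Sum>h\<in>F m. real (card {g \<in> F M. h \<otimes> g \<in> A}))
            = (\<Sum>h\<in>F m. \<Sum>g\<in>F M. of_bool (tr A g h))"
          using F_carrier by (intro sum.cong) (auto simp: tr_def Int_def subset_iff)
        also have "\<dots> = (\<Sum>g\<in>F M. \<Sum>h\<in>F m. of_bool (tr A g h))" by (rule sum.swap)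
        also have "\<dots> / real (card (F m)) = (\<Sum>g\<in>F M. f m (tr A g))"
          by (simp add: f_def sum_divide_distrib)
        finally show "real (card A) - \<eta> * real (card (F M)) \<le> (\<Sum>g\<in>F M. f m (tr A g))" .
      qed
    qed
  next
    case (midpoint u v)
    from midpoint.IH show ?case
    proof eventually_elim
      case (elim M)
      show ?case
      proof (intro allI impI)
        fix A assume "A \<subseteq> F M"
        then have "real (card A) - \<eta> * real (card (F M)) \<le> (\<Sum>g\<in>F M. u (tr A g))"
          "real (card A) - \<eta> * real (card (F M)) \<le> (\<Sum>g\<in>F M. v (tr A g))" using elim by auto
        then show "real (card A) - \<eta> * real (card (F M)) \<le> (\<Sum>g\<in>F M. (u (tr A g) + v (tr A g)) / 2)"
          by (simp add: sum_divide_distrib[symmetric] sum.distrib)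
      qed
    qed
  qed
  have lower: "\<exists>\<xi>\<in>Z. 3 * \<delta> / 4 \<le> u \<xi>" if u: "tail_mean f 0 u" for u
  proof -
    have "\<exists>\<^sub>F M in sequentially. (\<exists>A\<subseteq>F M. P A \<and> \<delta> * real (card (F M)) \<le> real (card A)) \<and>
        (\<forall>A\<subseteq>F M. real (card A) - \<delta> / 4 * real (card (F M)) \<le> (\<Sum>g\<in>F M. u (tr A g)))"
      using frequently_eventually_conj[OF freq average[OF u, of "\<delta> / 4"]] \<open>\<delta> > 0\<close>
      by (simp add: conj_commute)
    then obtain M A where A: "A \<subseteq> F M" "P A" "\<delta> * real (card (F M)) \<le> real (card A)"
      "real (card A) - \<delta> / 4 * real (card (F M)) \<le> (\<Sum>g\<in>F M. u (tr A g))"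
      by (auto dest!: frequently_ex)
    have "\<exists>g\<in>F M. 3 * \<delta> / 4 \<le> u (tr A g)"
    proof (rule ccontr)
      assume "\<not> ?thesis"
      then have "(\<Sum>g\<in>F M. u (tr A g)) < (\<Sum>g\<in>F M. 3 * \<delta> / 4)"
        by (intro sum_strict_mono) auto
      then show False using A(3,4) by (simp add: algebra_simps)
    qed
    then show ?thesis using tr_Z[OF A(2)] F_carrier by blast
  qed
  have "\<exists>\<xi>\<in>Z. \<exists>\<^sub>F m in sequentially. 3 * \<delta> / 4 - \<delta> / 4 \<le> f m \<xi>"
  proof (rule simons_limsup[OF \<open>compact Z\<close>])
    show "Z \<noteq> {}" using lower tail_mean.member[of 0 0 f] by blast
    show "continuous_on Z (f m)" for m
      unfolding f_def by (intro continuous_intros continuous_on_subset[OF coord]) auto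
    show "0 \<le> f m \<xi> \<and> f m \<xi> \<le> 1" for m \<xi>
    proof -
      have "(\<Sum>g\<in>F m. of_bool (\<xi> g) :: real) \<le> (\<Sum>g\<in>F m. 1)" by (rule sum_mono) simp
      then show ?thesis unfolding f_def by (auto simp: divide_le_eq intro!: divide_nonneg_nonneg sum_nonneg)
    qed
  qed (use lower \<open>\<delta> > 0\<close> in auto)
  then obtain \<xi> where \<xi>: "\<xi> \<in> Z" "\<exists>\<^sub>F m in sequentially. \<delta> / 2 \<le> f m \<xi>"
    by (auto simp: field_simps)
  have card_eq: "f m \<xi> = real (card ({h. \<xi> h} \<inter> F m)) / real (card (F m))" for m
    unfolding f_def by (simp add: Int_commute)
  have "\<exists>\<^sub>F m in sequentially. \<delta> / 2 * real (card (F m)) \<le> real (card ({h. \<xi> h} \<inter> F m))"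
    using \<xi>(2) by (rule frequently_elim1) (simp add: card_eq le_divide_eq)
  moreover have "P A" if "finite A" "A \<subseteq> {h. \<xi> h}" for A
    using \<xi>(1) that unfolding Z_def by blast
  moreover have "{h. \<xi> h} \<subseteq> carrier G"
  proof
    fix h assume "h \<in> {h. \<xi> h}"
    then have "finite {h}" "\<forall>a\<in>{h}. \<xi> a" by auto
    then show "h \<in> carrier G" using \<xi>(1) unfolding Z_def by blast
  qed
  ultimately show ?thesis by blast
qed

end

section \<open>Positive entropy and independence\<close>

text \<open>If only sets of density at most \<open>\<delta>\<close> are shattered, then there are at most
\<open>2 powr (\<gamma> \<delta> N) * (1 + (1 / 2) ^ \<gamma>) ^ N\<close> shattered sets, where \<open>N = card Z\<close>. Choosing \<open>\<beta>\<close>, then \<open>\<gamma>\<close>,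
then \<open>\<delta>\<close> makes each of the three exponents that arise from the bound of \<open>partial_sauer\<close> at most
\<open>c N / 3\<close>.\<close>
lemma shattering_dichotomy:
  fixes c :: real
  assumes "c > 0"
  shows "\<exists>\<delta>>0. \<forall>(P :: bool \<Rightarrow> 's \<Rightarrow> 'x set) E Z. finite Z \<longrightarrow>
    (\<forall>s\<in>Z. P True s \<inter> P False s = {}) \<longrightarrow>
    (\<forall>J\<subseteq>Z. shatters P E J \<longrightarrow> real (card J) \<le> \<delta> * real (card Z)) \<longrightarrow>
    (\<exists>\<Sigma>. finite \<Sigma> \<and> (\<forall>x\<in>E. \<exists>\<sigma>\<in>\<Sigma>. \<forall>s\<in>Z. x \<notin> P (\<not> \<sigma> s) s) \<and>
      real (card \<Sigma>) \<le> exp (c * real (card Z)))"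
proof -
  obtain \<beta> :: nat where \<beta>: "(1 / 2 :: real) ^ \<beta> < c / 3"
    using real_arch_pow_inv[of "c / 3" "1 / 2"] assms by auto
  obtain \<gamma> :: nat where \<gamma>: "(1 / 2 :: real) ^ \<gamma> < c / (3 * (real \<beta> + 1))"
    using real_arch_pow_inv[of "c / (3 * (real \<beta> + 1))" "1 / 2"] assms by auto
  define \<delta> where "\<delta> = c / (3 * (real \<beta> * real \<gamma> + 1))"
  have \<delta>: "\<delta> > 0" unfolding \<delta>_def using assms
    by (intro divide_pos_pos mult_pos_pos add_nonneg_pos mult_nonneg_nonneg) auto
  have b1: "real \<beta> * (1 / 2) ^ \<gamma> \<le> c / 3"
  proof -
    have "real \<beta> * (1 / 2) ^ \<gamma> \<le> (real \<beta> + 1) * (c / (3 * (real \<beta> + 1)))"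
      using \<gamma> by (intro mult_mono) auto
    also have "\<dots> = c / 3" by (simp add: field_simps)
    finally show ?thesis .
  qed
  have b2: "real \<beta> * real \<gamma> * \<delta> \<le> c / 3"
  proof -
    have "real \<beta> * real \<gamma> * \<delta> \<le> (real \<beta> * real \<gamma> + 1) * \<delta>" using \<delta> by (simp add: distrib_right)
    also have "\<dots> = c / 3"
    proof -
      have "real \<beta> * real \<gamma> + 1 > 0" by (intro add_nonneg_pos mult_nonneg_nonneg) auto
      then show ?thesis unfolding \<delta>_def by (simp add: field_simps)
    qed
    finally show ?thesis .
  qed
  have exp_bound: "(1 + a) ^ N \<le> exp (a * real N)" if "a \<ge> 0" for a :: real and N :: nat
  proof -
    have "(1 + a) ^ N \<le> exp a ^ N" using that exp_ge_add_one_self[of a] by (intro power_mono) auto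
    then show ?thesis by (simp add: exp_of_nat_mult[symmetric] mult.commute)
  qed
  have main: "\<exists>\<Sigma>. finite \<Sigma> \<and> (\<forall>x\<in>E. \<exists>\<sigma>\<in>\<Sigma>. \<forall>s\<in>Z. x \<notin> P (\<not> \<sigma> s) s) \<and>
      real (card \<Sigma>) \<le> exp (c * real (card Z))"
    if Z: "finite Z" and disj: "\<forall>s\<in>Z. P True s \<inter> P False s = {}"
      and small: "\<forall>J\<subseteq>Z. shatters P E J \<longrightarrow> real (card J) \<le> \<delta> * real (card Z)"
    for P :: "bool \<Rightarrow> 's \<Rightarrow> 'x set" and E Z
  proof -
    define N where "N = real (card Z)"
    define n where "n = real (shattered_count P E Z)"
    obtain \<Sigma> where \<Sigma>: "finite \<Sigma>" "\<forall>x\<in>E. \<exists>\<sigma>\<in>\<Sigma>. \<forall>s\<in>Z. x \<notin> P (\<not> \<sigma> s) s"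
      "real (card \<Sigma>) \<le> n ^ \<beta> * (1 + (1 / 2) ^ \<beta>) ^ card Z"
      using partial_sauer[OF Z, of P E \<beta>] disj unfolding n_def by blast
    have "n \<le> real (card {J. J \<subseteq> Z \<and> real (card J) \<le> \<delta> * N})"
      unfolding n_def shattered_count_def of_nat_le_iff
      by (rule card_mono) (use Z small in \<open>auto simp: N_def\<close>)
    also have "\<dots> \<le> 2 powr (real \<gamma> * (\<delta> * N)) * (1 + (1 / 2) ^ \<gamma>) ^ card Z"
      by (rule card_small_subsets_le[OF Z])
    also have "\<dots> \<le> exp (real \<gamma> * (\<delta> * N)) * exp ((1 / 2) ^ \<gamma> * N)"
    proof (intro mult_mono)
      have "ln 2 \<le> (1 :: real)" using ln_le_minus_one[of 2] by simp
      then have "real \<gamma> * (\<delta> * N) * ln 2 \<le> real \<gamma> * (\<delta> * N) * 1"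
        using \<delta> by (intro mult_left_mono) (auto simp: N_def)
      then show "2 powr (real \<gamma> * (\<delta> * N)) \<le> exp (real \<gamma> * (\<delta> * N))"
        by (simp add: powr_def)
    qed (auto simp: N_def exp_bound)
    finally have n: "n \<le> exp (real \<gamma> * \<delta> * N + (1 / 2) ^ \<gamma> * N)"
      by (simp add: exp_add mult.assoc)
    have "real (card \<Sigma>) \<le> exp (real \<gamma> * \<delta> * N + (1 / 2) ^ \<gamma> * N) ^ \<beta> * exp ((1 / 2) ^ \<beta> * N)"
      by (rule order_trans[OF \<Sigma>(3)])
        (intro mult_mono power_mono n exp_bound, auto simp: n_def N_def exp_bound)
    also have "\<dots> = exp ((real \<beta> * real \<gamma> * \<delta> + real \<beta> * (1 / 2) ^ \<gamma> + (1 / 2) ^ \<beta>) * N)"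
      by (simp add: exp_of_nat_mult[symmetric] exp_add[symmetric] algebra_simps)
    also have "\<dots> \<le> exp (c * N)"
    proof -
      have "(real \<beta> * real \<gamma> * \<delta> + real \<beta> * (1 / 2) ^ \<gamma> + (1 / 2) ^ \<beta>) * N \<le> c * N"
        by (rule mult_right_mono) (use b1 b2 \<beta> in \<open>auto simp: N_def\<close>)
      then show ?thesis by simp
    qed
    finally show ?thesis using \<Sigma>(1,2) unfolding N_def by blast
  qed
  show ?thesis
    by (rule exI[of _ \<delta>]) (intro conjI \<delta> allI impI, rule main)
qed

text \<open>The patterns in \<open>\<Sigma> U\<close> predict when the orbit is in \<open>U\<close>: a value \<open>True\<close> of the pattern attached
to a point guarantees that it is, and is forced while the orbit is in \<open>K U\<close>. As the sets \<open>K U\<close>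
cover \<open>X\<close>, a choice of one pattern for each \<open>U\<close> determines an element of the join.\<close>
lemma cover_number_le_prod:
  fixes \<Sigma> :: "'x set \<Rightarrow> ('g \<Rightarrow> bool) set"
  assumes "finite \<U>" and D: "finite D" and "E \<subseteq> X"
    and act: "\<And>s x. s \<in> D \<Longrightarrow> x \<in> X \<Longrightarrow> act s x \<in> X"
    and K: "X \<subseteq> (\<Union>U\<in>\<U>. K U)"
    and fin: "\<And>U. U \<in> \<U> \<Longrightarrow> finite (\<Sigma> U)"
    and \<Sigma>: "\<And>U x. U \<in> \<U> \<Longrightarrow> x \<in> E \<Longrightarrow>
      \<exists>\<sigma>\<in>\<Sigma> U. \<forall>s\<in>D. (\<sigma> s \<longrightarrow> act s x \<in> U) \<and> (act s x \<in> K U \<longrightarrow> \<sigma> s)"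
  shows "cover_number (cover_Join D (\<lambda>g. translate_cover X act g \<U>)) E \<le> (\<Prod>U\<in>\<U>. card (\<Sigma> U))"
proof -
  define T where "T = {\<tau> \<in> Pi\<^sub>E \<U> \<Sigma>. \<forall>s\<in>D. \<exists>U\<in>\<U>. \<tau> U s}"
  define pick where "pick \<tau> s = (SOME U. U \<in> \<U> \<and> \<tau> U s)" for \<tau> :: "'x set \<Rightarrow> 'g \<Rightarrow> bool" and s
  define W where "W \<tau> = (\<Inter>s\<in>D. {x \<in> X. act s x \<in> pick \<tau> s})" for \<tau>
  have pick: "pick \<tau> s \<in> \<U> \<and> \<tau> (pick \<tau> s) s" if "\<tau> \<in> T" "s \<in> D" for \<tau> s
    unfolding pick_def by (rule someI_ex) (use that in \<open>auto simp: T_def\<close>)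
  have finPi: "finite (Pi\<^sub>E \<U> \<Sigma>)" by (rule finite_PiE) (use \<open>finite \<U>\<close> fin in auto)
  then have finT: "finite T" unfolding T_def by simp
  have "W ` T \<subseteq> cover_Join D (\<lambda>g. translate_cover X act g \<U>)"
  proof
    fix w assume "w \<in> W ` T"
    then obtain \<tau> where \<tau>: "\<tau> \<in> T" "w = W \<tau>" by blast
    have "\<forall>s\<in>D. {x \<in> X. act s x \<in> pick \<tau> s} \<in> translate_cover X act s \<U>"
      using pick[OF \<tau>(1)] unfolding translate_cover_def by blast
    then show "w \<in> cover_Join D (\<lambda>g. translate_cover X act g \<U>)"
      unfolding cover_Join_def \<tau>(2) W_def by blast
  qed
  moreover have "E \<subseteq> \<Union>(W ` T)"
  proof
    fix x assume x: "x \<in> E"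
    have "\<forall>U\<in>\<U>. \<exists>\<sigma>. \<sigma> \<in> \<Sigma> U \<and> (\<forall>s\<in>D. (\<sigma> s \<longrightarrow> act s x \<in> U) \<and> (act s x \<in> K U \<longrightarrow> \<sigma> s))"
      using \<Sigma>[OF _ x] by blast
    from bchoice[OF this] obtain \<sigma> where \<sigma>: "\<And>U. U \<in> \<U> \<Longrightarrow> \<sigma> U \<in> \<Sigma> U"
      "\<And>U s. U \<in> \<U> \<Longrightarrow> s \<in> D \<Longrightarrow> \<sigma> U s \<Longrightarrow> act s x \<in> U"
      "\<And>U s. U \<in> \<U> \<Longrightarrow> s \<in> D \<Longrightarrow> act s x \<in> K U \<Longrightarrow> \<sigma> U s"
      by metis
    define \<tau> where "\<tau> = restrict \<sigma> \<U>"
    have "\<exists>U\<in>\<U>. \<tau> U s" if s: "s \<in> D" for s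
    proof -
      have "act s x \<in> X" using act[OF s] x \<open>E \<subseteq> X\<close> by blast
      then obtain U where "U \<in> \<U>" "act s x \<in> K U" using K by blast
      then show ?thesis using \<sigma>(3)[OF _ s] unfolding \<tau>_def by auto
    qed
    then have \<tau>: "\<tau> \<in> T" unfolding T_def \<tau>_def using \<sigma>(1) by auto
    have "act s x \<in> pick \<tau> s" if "s \<in> D" for s
      using pick[OF \<tau> that] \<sigma>(2)[OF _ that] unfolding \<tau>_def by auto
    then have "x \<in> W \<tau>" unfolding W_def using x \<open>E \<subseteq> X\<close> by blast
    then show "x \<in> \<Union>(W ` T)" using \<tau> by blast
  qed
  ultimately have "cover_number (cover_Join D (\<lambda>g. translate_cover X act g \<U>)) E \<le> card (W ` T)"
    unfolding cover_number_def using finT by (intro Least_le exI[of _ "W ` T"]) auto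
  also have "\<dots> \<le> card T" by (rule card_image_le[OF finT])
  also have "\<dots> \<le> card (Pi\<^sub>E \<U> \<Sigma>)" by (rule card_mono[OF finPi]) (auto simp: T_def)
  also have "\<dots> = (\<Prod>U\<in>\<U>. card (\<Sigma> U))" by (rule card_PiE[OF \<open>finite \<U>\<close>])
  finally show ?thesis .
qed

lemma finite_open_cover_shrink:
  fixes X :: "'x::metric_space set"
  assumes "compact X" "finite_open_cover X \<U>"
  shows "\<exists>K. (\<forall>U\<in>\<U>. compact (K U) \<and> K U \<subseteq> U) \<and> X \<subseteq> (\<Union>U\<in>\<U>. K U)"
proof -
  have U: "finite \<U>" "\<And>U. U \<in> \<U> \<Longrightarrow> \<exists>O'. open O' \<and> U = X \<inter> O'" "\<Union>\<U> = X"
    using assms(2) unfolding finite_open_cover_def openin_open by auto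
  from U(2) have "\<forall>U\<in>\<U>. \<exists>O'. open O' \<and> U = X \<inter> O'" by blast
  from bchoice[OF this] obtain Q where
    Q_open: "\<And>U. U \<in> \<U> \<Longrightarrow> open (Q U)" and Q: "\<And>U. U \<in> \<U> \<Longrightarrow> U = X \<inter> Q U" by blast
  have "X \<subseteq> \<Union>(Q ` \<U>)" using U(3) Q by blast
  then obtain e where e: "e > 0" "\<And>x. x \<in> X \<Longrightarrow> \<exists>G\<in>Q ` \<U>. ball x e \<subseteq> G"
    using Heine_Borel_lemma[OF assms(1), of "Q ` \<U>"] Q_open by blast
  define K where "K U = X \<inter> (\<Inter>y\<in>X - U. {x. e \<le> dist x y})" for U
  have "compact (K U)" for U
    unfolding K_def
    by (intro compact_Int_closed assms(1) closed_INT ballI closed_Collect_le continuous_intros)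
  moreover have "K U \<subseteq> U" for U
    unfolding K_def using e(1) by force
  moreover have "X \<subseteq> (\<Union>U\<in>\<U>. K U)"
  proof
    fix x assume x: "x \<in> X"
    then obtain U where U: "U \<in> \<U>" "ball x e \<subseteq> Q U" using e(2) by blast
    have "x \<in> K U" unfolding K_def
    proof (intro IntI x INT_I CollectI)
      fix y assume "y \<in> X - U"
      then have "y \<notin> ball x e" using U Q[OF U(1)] by blast
      then show "e \<le> dist x y" by simp
    qed
    then show "x \<in> (\<Union>U\<in>\<U>. K U)" using U(1) by blast
  qed
  ultimately show ?thesis by blast
qed

text \<open>The set \<open>H\<close> is independent for the family \<open>B\<close> indexed by \<open>I\<close>, within a single fibre of \<open>\<pi>\<close>: every
itinerary \<open>\<omega>\<close> through the sets \<open>B i\<close> along \<open>H\<close> is followed by a point of the fibre over \<open>y\<close>. The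
itinerary is a total function, of which only the values on \<open>H\<close> matter.\<close>
definition fibre_independent ::
  "'x set \<Rightarrow> ('g \<Rightarrow> 'x \<Rightarrow> 'x) \<Rightarrow> ('x \<Rightarrow> 'y) \<Rightarrow> 'i set \<Rightarrow> ('i \<Rightarrow> 'x set) \<Rightarrow> 'g set \<Rightarrow> bool" where
  "fibre_independent X act \<pi> I B H \<longleftrightarrow>
     (\<exists>y. \<forall>\<omega>. (\<forall>h. \<omega> h \<in> I) \<longrightarrow> (\<exists>x\<in>X. \<pi> x = y \<and> (\<forall>h\<in>H. act h x \<in> B (\<omega> h))))"

text \<open>Shrink \<open>\<U>\<close> to a cover by compact sets \<open>K U \<subseteq> U\<close>. If, for some \<open>m\<close>, no pair \<open>(X - U, K U)\<close> had an
independent subset of \<open>F m\<close> of density \<open>\<delta>\<close>, then \<open>shattering_dichotomy\<close> would bound the number of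
patterns for each \<open>U\<close>, and \<open>cover_number_le_prod\<close> would make the normalised entropy over \<open>F m\<close>
smaller than \<open>c\<close>. As \<open>\<U>\<close> is finite, one pair serves for infinitely many \<open>m\<close>.\<close>
lemma positive_entropy_imp_independent_pair:
  fixes X :: "'x::metric_space set" and F :: "nat \<Rightarrow> 'g set"
  assumes X: "compact X" and \<U>: "finite_open_cover X \<U>"
    and F: "\<And>m. finite (F m)"  "\<And>m. F m \<noteq> {}"
    and act: "\<And>m s x. s \<in> F m \<Longrightarrow> x \<in> X \<Longrightarrow> act s x \<in> X"
    and "c > 0"
    and freq: "\<exists>\<^sub>F m in sequentially. c \<le> rel_cover_entropy X Y \<pi>
       (cover_Join (F m) (\<lambda>g. translate_cover X act g \<U>)) / real (card (F m))"
  shows "\<exists>A \<delta>. (\<forall>v::bool. compact (A v) \<and> A v \<subseteq> X) \<and> A True \<inter> A False = {} \<and> \<delta> > 0 \<and>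
    (\<exists>\<^sub>F m in sequentially. \<exists>J\<subseteq>F m. fibre_independent X act \<pi> UNIV A J \<and>
       \<delta> * real (card (F m)) \<le> real (card J))"
proof -
  obtain K where K: "\<And>U. U \<in> \<U> \<Longrightarrow> compact (K U)" "\<And>U. U \<in> \<U> \<Longrightarrow> K U \<subseteq> U"
    "X \<subseteq> (\<Union>U\<in>\<U>. K U)"
    using finite_open_cover_shrink[OF X \<U>] by blast
  have fin\<U>: "finite \<U>" and sub: "\<And>U. U \<in> \<U> \<Longrightarrow> openin (top_of_set X) U" "\<And>U. U \<in> \<U> \<Longrightarrow> U \<subseteq> X"
    using \<U> unfolding finite_open_cover_def by auto
  define A where "A U v = (if v then K U else X - U)" for U and v :: bool
  define P where "P U v s = {x \<in> X. act s x \<in> A U v}" for U v s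
  define r where "r = card \<U>"
  define d where "d = c / (2 * (real r + 1))"
  have d: "d > 0" "real r * d \<le> c / 2"
    unfolding d_def using \<open>c > 0\<close> by (auto simp: field_simps)
  obtain \<delta> where \<delta>: "\<delta> > 0" and dich: "\<And>(P :: bool \<Rightarrow> 'g \<Rightarrow> 'x set) E Z. finite Z \<Longrightarrow>
    (\<forall>s\<in>Z. P True s \<inter> P False s = {}) \<Longrightarrow>
    (\<forall>J\<subseteq>Z. shatters P E J \<longrightarrow> real (card J) \<le> \<delta> * real (card Z)) \<Longrightarrow>
    (\<exists>\<Sigma>. finite \<Sigma> \<and> (\<forall>x\<in>E. \<exists>\<sigma>\<in>\<Sigma>. \<forall>s\<in>Z. x \<notin> P (\<not> \<sigma> s) s) \<and>
      real (card \<Sigma>) \<le> exp (d * real (card Z)))"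
    using shattering_dichotomy[OF d(1), where 's = 'g and 'x = 'x] by blast
  have disj: "A U True \<inter> A U False = {}" if "U \<in> \<U>" for U
    unfolding A_def using K(2)[OF that] by auto
  have shatters_imp: "fibre_independent X act \<pi> UNIV (A U) J"
    if "shatters (P U) {x \<in> X. \<pi> x = y} J" for U y J
    unfolding fibre_independent_def
  proof (intro exI[of _ y] allI impI)
    fix \<omega> :: "'g \<Rightarrow> bool"
    from that obtain x where "x \<in> {x \<in> X. \<pi> x = y}" "\<forall>s\<in>J. x \<in> P U (\<omega> s) s"
      unfolding shatters_def by blast
    then show "\<exists>x\<in>X. \<pi> x = y \<and> (\<forall>h\<in>J. act h x \<in> A U (\<omega> h))"
      unfolding P_def by blast
  qed
  have "\<exists>\<^sub>F m in sequentially. \<exists>U\<in>\<U>. \<exists>J\<subseteq>F m. fibre_independent X act \<pi> UNIV (A U) J \<and>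
       \<delta> * real (card (F m)) \<le> real (card J)"
    using freq
  proof (rule frequently_elim1)
    fix m
    define N where "N = real (card (F m))"
    define \<W> where "\<W> = cover_Join (F m) (\<lambda>g. translate_cover X act g \<U>)"
    assume "c \<le> rel_cover_entropy X Y \<pi>
       (cover_Join (F m) (\<lambda>g. translate_cover X act g \<U>)) / real (card (F m))"
    then have ent: "c \<le> ln (real (rel_cover_number X Y \<pi> \<W>)) / N"
      unfolding rel_cover_entropy_def \<W>_def N_def .
    have N: "N > 0" unfolding N_def using F by (simp add: card_gt_0_iff)
    show "\<exists>U\<in>\<U>. \<exists>J\<subseteq>F m. fibre_independent X act \<pi> UNIV (A U) J \<and>
       \<delta> * real (card (F m)) \<le> real (card J)"
    proof (rule ccontr)
      assume none: "\<not> ?thesis"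
      have bound: "real (cover_number \<W> {x \<in> X. \<pi> x = y}) \<le> exp (d * N) ^ r" for y
      proof -
        have "\<exists>\<Sigma>. finite \<Sigma> \<and> (\<forall>x\<in>{x \<in> X. \<pi> x = y}. \<exists>\<sigma>\<in>\<Sigma>. \<forall>s\<in>F m. x \<notin> P U (\<not> \<sigma> s) s) \<and>
            real (card \<Sigma>) \<le> exp (d * real (card (F m)))" if U: "U \<in> \<U>" for U
        proof (rule dich[OF F(1)])
          show "\<forall>s\<in>F m. P U True s \<inter> P U False s = {}" using disj[OF U] unfolding P_def by blast
          show "\<forall>J\<subseteq>F m. shatters (P U) {x \<in> X. \<pi> x = y} J \<longrightarrow> real (card J) \<le> \<delta> * real (card (F m))"
          proof (intro allI impI)
            fix J assume "J \<subseteq> F m" "shatters (P U) {x \<in> X. \<pi> x = y} J"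
            then have "\<not> \<delta> * real (card (F m)) \<le> real (card J)"
              using none shatters_imp U by blast
            then show "real (card J) \<le> \<delta> * real (card (F m))" by linarith
          qed
        qed
        then have "\<forall>U\<in>\<U>. \<exists>\<Sigma>. finite \<Sigma> \<and> (\<forall>x\<in>{x \<in> X. \<pi> x = y}. \<exists>\<sigma>\<in>\<Sigma>. \<forall>s\<in>F m. x \<notin> P U (\<not> \<sigma> s) s) \<and>
            real (card \<Sigma>) \<le> exp (d * N)" unfolding N_def by blast
        from bchoice[OF this] obtain \<Sigma> where \<Sigma>: "\<And>U. U \<in> \<U> \<Longrightarrow> finite (\<Sigma> U)"
          "\<And>U x. U \<in> \<U> \<Longrightarrow> x \<in> {x \<in> X. \<pi> x = y} \<Longrightarrow> \<exists>\<sigma>\<in>\<Sigma> U. \<forall>s\<in>F m. x \<notin> P U (\<not> \<sigma> s) s"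
          "\<And>U. U \<in> \<U> \<Longrightarrow> real (card (\<Sigma> U)) \<le> exp (d * N)" by blast
        have "cover_number \<W> {x \<in> X. \<pi> x = y} \<le> (\<Prod>U\<in>\<U>. card (\<Sigma> U))"
          unfolding \<W>_def
        proof (rule cover_number_le_prod[OF fin\<U> F(1) _ act K(3) \<Sigma>(1)])
          fix U x assume Ux: "U \<in> \<U>" "x \<in> {x \<in> X. \<pi> x = y}"
          then obtain \<sigma> where \<sigma>: "\<sigma> \<in> \<Sigma> U" "\<forall>s\<in>F m. x \<notin> P U (\<not> \<sigma> s) s" using \<Sigma>(2) by blast
          have "(\<sigma> s \<longrightarrow> act s x \<in> U) \<and> (act s x \<in> K U \<longrightarrow> \<sigma> s)" if "s \<in> F m" for s
            using bspec[OF \<sigma>(2) that] act[OF that, of x] Ux(2) unfolding P_def A_def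
            by (cases "\<sigma> s") auto
          then show "\<exists>\<sigma>\<in>\<Sigma> U. \<forall>s\<in>F m. (\<sigma> s \<longrightarrow> act s x \<in> U) \<and> (act s x \<in> K U \<longrightarrow> \<sigma> s)"
            using \<sigma>(1) by blast
        qed auto
        then have "real (cover_number \<W> {x \<in> X. \<pi> x = y}) \<le> (\<Prod>U\<in>\<U>. real (card (\<Sigma> U)))"
          using of_nat_mono[where 'a = real] unfolding of_nat_prod[symmetric] by blast
        also have "\<dots> \<le> (\<Prod>U\<in>\<U>. exp (d * N))" by (rule prod_mono) (use \<Sigma>(3) in auto)
        finally show ?thesis unfolding r_def by simp
      qed
      define R where "R = rel_cover_number X Y \<pi> \<W>"
      have R_le: "real R \<le> exp (d * N) ^ r"
      proof (cases "Y = {}")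
        case True
        then show ?thesis unfolding R_def rel_cover_number_def by simp
      next
        case False
        have "R \<le> nat \<lfloor>exp (d * N) ^ r\<rfloor>"
          unfolding R_def rel_cover_number_def
          by (rule cSUP_least[OF False]) (use bound in \<open>simp add: le_nat_floor\<close>)
        then show ?thesis by (simp add: le_nat_iff le_floor_iff nat_le_iff)
      qed
      have "ln (real R) \<le> c / 2 * N"
      proof (cases "R = 0")
        case False
        then have "ln (real R) \<le> ln (exp (d * N) ^ r)" using R_le by (intro ln_mono) auto
        also have "\<dots> = real r * d * N" by (simp add: exp_of_nat_mult[symmetric])
        also have "\<dots> \<le> c / 2 * N" using d(2) N by (intro mult_right_mono) auto
        finally show ?thesis .
      qed (use N \<open>c > 0\<close> in auto)
      moreover have "c * N \<le> ln (real R)" using ent N unfolding R_def by (simp add: le_divide_eq)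
      moreover have "c / 2 * N < c * N" using N \<open>c > 0\<close> by simp
      ultimately show False by linarith
    qed
  qed
  then have "\<exists>U\<in>\<U>. \<exists>\<^sub>F m in sequentially. \<exists>J\<subseteq>F m. fibre_independent X act \<pi> UNIV (A U) J \<and>
       \<delta> * real (card (F m)) \<le> real (card J)"
    by (rule frequently_bex_finite[OF fin\<U>])
  then obtain U where U: "U \<in> \<U>" "\<exists>\<^sub>F m in sequentially. \<exists>J\<subseteq>F m.
       fibre_independent X act \<pi> UNIV (A U) J \<and> \<delta> * real (card (F m)) \<le> real (card J)" by blast
  have "closedin (top_of_set X) (X - U)" using sub(1)[OF U(1)] by (simp add: closedin_diff)
  then have "compact (X - U)" using X closedin_compact by blast
  then have "compact (A U v) \<and> A U v \<subseteq> X" for v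
    unfolding A_def using K(1,2)[OF U(1)] sub(2)[OF U(1)] by auto
  then show ?thesis using disj[OF U(1)] \<delta> U(2) by blast
qed

section \<open>Independence along infinite sets and families of disjoint sets\<close>

text \<open>Compactness is used twice: in the base to find a common \<open>y\<close> for all itineraries, and then
in the fibre over \<open>y\<close> to find a point following a given itinerary along all of \<open>H\<close>.\<close>
lemma fibre_independent_of_finite_subsets:
  fixes X :: "'x::metric_space set" and \<pi> :: "'x \<Rightarrow> 'y::metric_space"
    and act :: "'g \<Rightarrow> 'x \<Rightarrow> 'x" and I :: "'i set"
  assumes X: "compact X" and act: "\<And>h. h \<in> H \<Longrightarrow> continuous_on X (act h)"
    and \<pi>: "continuous_on X \<pi>" and B: "\<And>i. i \<in> I \<Longrightarrow> closed (B i)"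
    and fin: "\<And>A. finite A \<Longrightarrow> A \<subseteq> H \<Longrightarrow> fibre_independent X act \<pi> I B A"
  shows "fibre_independent X act \<pi> I B H"
proof (cases "I = {}")
  case True
  then show ?thesis unfolding fibre_independent_def by auto
next
  case False
  then obtain i0 where i0: "i0 \<in> I" by blast
  define D where "D h i = X \<inter> act h -` B i" for h i
  have D_closed: "closed (D h i)" if "h \<in> H" "i \<in> I" for h i
    unfolding D_def by (intro continuous_closed_preimage act B that compact_imp_closed X)
  define C where "C \<omega> A = X \<inter> (\<Inter>h\<in>A. D h (\<omega> h))" for \<omega> A
  define \<F> :: "(('g \<Rightarrow> 'i) \<times> 'g set) set" where "\<F> = {(\<omega>, A). (\<forall>h. \<omega> h \<in> I) \<and> finite A \<and> A \<subseteq> H}"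
  have F_D: "finite (snd p)" "snd p \<subseteq> H" "\<forall>h. fst p h \<in> I" if "p \<in> \<F>" for p
    using that unfolding \<F>_def by auto
  have C_compact: "compact (C \<omega> A)" if "(\<omega>, A) \<in> \<F>" for \<omega> A
    unfolding C_def using that D_closed unfolding \<F>_def
    by (intro compact_Int_closed X closed_INT) auto
  have image_closed: "closed (\<pi> ` C \<omega> A)" if "(\<omega>, A) \<in> \<F>" for \<omega> A
  proof -
    have "continuous_on (C \<omega> A) \<pi>" by (rule continuous_on_subset[OF \<pi>]) (auto simp: C_def)
    then show ?thesis by (intro compact_imp_closed compact_continuous_image C_compact that)
  qed
  have "\<pi> ` X \<inter> (\<Inter>p\<in>\<F>. \<pi> ` C (fst p) (snd p)) \<noteq> {}"
  proof (rule compact_imp_fip_image)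
    show "compact (\<pi> ` X)" by (intro compact_continuous_image \<pi> X)
    show "closed (\<pi> ` C (fst p) (snd p))" if "p \<in> \<F>" for p
      using image_closed[of "fst p" "snd p"] that by simp
    fix \<G> assume \<G>: "finite \<G>" "\<G> \<subseteq> \<F>"
    have "fibre_independent X act \<pi> I B (\<Union>p\<in>\<G>. snd p)"
    proof (rule fin)
      show "finite (\<Union>p\<in>\<G>. snd p)" using \<G> F_D by (intro finite_UN_I) auto
      show "(\<Union>p\<in>\<G>. snd p) \<subseteq> H" using \<G>(2) F_D by blast
    qed
    then obtain y where y: "\<And>\<omega>. (\<forall>h. \<omega> h \<in> I) \<Longrightarrow>
        \<exists>x\<in>X. \<pi> x = y \<and> (\<forall>h\<in>(\<Union>p\<in>\<G>. snd p). act h x \<in> B (\<omega> h))"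
      unfolding fibre_independent_def by blast
    have "y \<in> \<pi> ` X" using y[of "\<lambda>_. i0"] i0 by auto
    moreover have "y \<in> \<pi> ` C (fst p) (snd p)" if p: "p \<in> \<G>" for p
    proof -
      obtain x where x: "x \<in> X" "\<pi> x = y" "\<forall>h\<in>(\<Union>p\<in>\<G>. snd p). act h x \<in> B (fst p h)"
        using y[OF F_D(3)[OF subsetD[OF \<G>(2) p]]] by blast
      have "x \<in> C (fst p) (snd p)" unfolding C_def D_def using p x(1,3) by blast
      then show ?thesis using x(2) by blast
    qed
    ultimately show "\<pi> ` X \<inter> (\<Inter>p\<in>\<G>. \<pi> ` C (fst p) (snd p)) \<noteq> {}" by blast
  qed
  then obtain y where y: "\<And>\<omega> A. (\<omega>, A) \<in> \<F> \<Longrightarrow> y \<in> \<pi> ` C \<omega> A" by fastforce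
  show ?thesis unfolding fibre_independent_def
  proof (intro exI[of _ y] allI impI)
    fix \<omega> :: "'g \<Rightarrow> 'i" assume \<omega>: "\<forall>h. \<omega> h \<in> I"
    have "(X \<inter> \<pi> -` {y}) \<inter> (\<Inter>h\<in>H. D h (\<omega> h)) \<noteq> {}"
    proof (rule compact_imp_fip_image)
      have "closed (X \<inter> \<pi> -` {y})"
        by (intro continuous_closed_preimage \<pi> compact_imp_closed X) simp
      then show "compact (X \<inter> \<pi> -` {y})"
        using compact_Int_closed[OF X, of "X \<inter> \<pi> -` {y}"] by simp
      show "closed (D h (\<omega> h))" if "h \<in> H" for h by (rule D_closed) (use \<omega> that in auto)
      fix A assume "finite A" "A \<subseteq> H"
      then have "y \<in> \<pi> ` C \<omega> A" using y \<omega> unfolding \<F>_def by blast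
      then show "X \<inter> \<pi> -` {y} \<inter> (\<Inter>h\<in>A. D h (\<omega> h)) \<noteq> {}" unfolding C_def by blast
    qed
    then show "\<exists>x\<in>X. \<pi> x = y \<and> (\<forall>h\<in>H. act h x \<in> B (\<omega> h))" unfolding D_def by blast
  qed
qed

lemma fibre_independent_mono:
  "fibre_independent X act \<pi> I B A \<Longrightarrow> A' \<subseteq> A \<Longrightarrow> fibre_independent X act \<pi> I B A'"
  unfolding fibre_independent_def by (meson subsetD)

lemma fibre_independent_translate:
  fixes G :: "('g, 'b) monoid_scheme" (structure) and I :: "'i set"
  assumes "group_action G X act" and eq: "\<And>x. x \<in> X \<Longrightarrow> \<pi> (act g x) = actY g (\<pi> x)"
    and A: "A \<subseteq> carrier G" "fibre_independent X act \<pi> I B A" and g: "g \<in> carrier G"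
  shows "fibre_independent X act \<pi> I B {h \<in> carrier G. h \<otimes> g \<in> A}"
proof -
  interpret group_action G X act by fact
  interpret group G using group_hom group_hom.axioms(1) by blast
  obtain y where y: "\<And>\<omega>. (\<forall>h. \<omega> h \<in> I) \<Longrightarrow> \<exists>x\<in>X. \<pi> x = y \<and> (\<forall>h\<in>A. act h x \<in> B (\<omega> h))"
    using A(2) unfolding fibre_independent_def by blast
  show ?thesis unfolding fibre_independent_def
  proof (intro exI[of _ "actY g y"] allI impI)
    fix \<omega> :: "'g \<Rightarrow> 'i" assume \<omega>: "\<forall>h. \<omega> h \<in> I"
    obtain x where x: "x \<in> X" "\<pi> x = y" "\<forall>h\<in>A. act h x \<in> B (\<omega> (h \<otimes> inv g))"
      using y[of "\<lambda>h. \<omega> (h \<otimes> inv g)"] \<omega> by blast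
    have "act h (act g x) \<in> B (\<omega> h)" if h: "h \<in> carrier G" "h \<otimes> g \<in> A" for h
    proof -
      have "act (h \<otimes> g) x \<in> B (\<omega> (h \<otimes> g \<otimes> inv g))" using x(3) h(2) by blast
      then show ?thesis using composition_rule[OF x(1) h(1) g] h(1) g by (simp add: m_assoc)
    qed
    moreover have "act g x \<in> X" using element_image g x(1) by blast
    ultimately show "\<exists>x\<in>X. \<pi> x = actY g y \<and> (\<forall>h\<in>{h \<in> carrier G. h \<otimes> g \<in> A}. act h x \<in> B (\<omega> h))"
      using eq[OF x(1)] x(2) by (intro bexI[of _ "act g x"]) auto
  qed
qed

text \<open>Independence of a pair passes to the sets of points that \<open>e i\<close> sends into \<open>A True\<close> and the
other elements of \<open>S\<close> send into \<open>A False\<close>, along those \<open>h\<close> for which the translates \<open>S h\<close> are pairwise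
disjoint and contained in \<open>J\<close>.\<close>
lemma fibre_independent_pattern:
  fixes G :: "('g, 'b) monoid_scheme" (structure) and I :: "'i set"
  assumes "group_action G X act" and S: "S \<subseteq> carrier G" and H: "H \<subseteq> carrier G"
    and J: "fibre_independent X act \<pi> UNIV A J"
    and sub: "\<And>s h. s \<in> S \<Longrightarrow> h \<in> H \<Longrightarrow> s \<otimes> h \<in> J"
    and disj: "\<And>s s' h h'. s \<in> S \<Longrightarrow> s' \<in> S \<Longrightarrow> h \<in> H \<Longrightarrow> h' \<in> H \<Longrightarrow>
      s \<otimes> h = s' \<otimes> h' \<Longrightarrow> h = h'"
  shows "fibre_independent X act \<pi> I (\<lambda>i. {x \<in> X. \<forall>s\<in>S. act s x \<in> A (s = e i)}) H"
proof -
  interpret group_action G X act by fact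
  interpret group G using group_hom group_hom.axioms(1) by blast
  obtain y where y: "\<And>\<omega>. \<exists>x\<in>X. \<pi> x = y \<and> (\<forall>h\<in>J. act h x \<in> A (\<omega> h))"
    using J unfolding fibre_independent_def by auto
  show ?thesis unfolding fibre_independent_def
  proof (intro exI[of _ y] allI impI)
    fix \<omega> :: "'g \<Rightarrow> 'i"
    define \<omega>' where "\<omega>' j \<longleftrightarrow> (\<exists>s\<in>S. \<exists>h\<in>H. j = s \<otimes> h \<and> s = e (\<omega> h))" for j
    have \<omega>': "\<omega>' (s \<otimes> h) = (s = e (\<omega> h))" if "s \<in> S" "h \<in> H" for s h
    proof
      assume "\<omega>' (s \<otimes> h)"
      then obtain s' h' where *: "s' \<in> S" "h' \<in> H" "s \<otimes> h = s' \<otimes> h'" "s' = e (\<omega> h')"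
        unfolding \<omega>'_def by blast
      have "h = h'" using disj[OF that(1) *(1) that(2) *(2,3)] .
      moreover have "s = s'" using * that S H \<open>h = h'\<close> by (metis right_cancel subsetD)
      ultimately show "s = e (\<omega> h)" using *(4) by simp
    qed (use that in \<open>auto simp: \<omega>'_def\<close>)
    obtain x where x: "x \<in> X" "\<pi> x = y" "\<And>h. h \<in> J \<Longrightarrow> act h x \<in> A (\<omega>' h)"
      using y by blast
    have "act h x \<in> {x \<in> X. \<forall>s\<in>S. act s x \<in> A (s = e (\<omega> h))}" if h: "h \<in> H" for h
    proof (intro CollectI conjI ballI)
      show "act h x \<in> X" using element_image h H x(1) by blast
      fix s assume s: "s \<in> S"
      have "act (s \<otimes> h) x \<in> A (s = e (\<omega> h))" using x(3)[OF sub[OF s h]] \<omega>'[OF s h] by simp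
      then show "act s (act h x) \<in> A (s = e (\<omega> h))"
        using composition_rule[OF x(1) subsetD[OF S s] subsetD[OF H h]] by simp
    qed
    then show "\<exists>x\<in>X. \<pi> x = y \<and> (\<forall>h\<in>H. act h x \<in> {x \<in> X. \<forall>s\<in>S. act s x \<in> A (s = e (\<omega> h))})"
      using x(1,2) by blast
  qed
qed

lemma pairwise_disjoint_compact_separated:
  fixes B :: "'i \<Rightarrow> 'x::metric_space set"
  assumes "finite I" and B: "\<And>i. i \<in> I \<Longrightarrow> compact (B i)"
    and disj: "\<And>i j. i \<in> I \<Longrightarrow> j \<in> I \<Longrightarrow> i \<noteq> j \<Longrightarrow> B i \<inter> B j = {}"
  shows "\<exists>\<eta>>0. \<forall>i\<in>I. \<forall>j\<in>I. i \<noteq> j \<longrightarrow> (\<forall>x\<in>B i. \<forall>y\<in>B j. \<eta> \<le> dist x y)"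
proof -
  define R where "R = {p \<in> I \<times> I. fst p \<noteq> snd p}"
  have "\<exists>d>0. \<forall>x\<in>B (fst p). \<forall>y\<in>B (snd p). d \<le> dist x y"
    if "p \<in> R" for p
  proof -
    have p: "fst p \<in> I" "snd p \<in> I" "fst p \<noteq> snd p" using that unfolding R_def by auto
    have cpt: "compact (B (fst p) \<times> B (snd p))" using B p by (intro compact_Times) auto
    show ?thesis
    proof (cases "B (fst p) \<times> B (snd p) = {}")
      case False
      have "continuous_on (B (fst p) \<times> B (snd p)) (\<lambda>q. dist (fst q) (snd q))"
        by (intro continuous_intros)
      from continuous_attains_inf[OF cpt False this]
      obtain q where q: "q \<in> B (fst p) \<times> B (snd p)"
        "\<And>q'. q' \<in> B (fst p) \<times> B (snd p) \<Longrightarrow> dist (fst q) (snd q) \<le> dist (fst q') (snd q')"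
        by blast
      have "fst q \<noteq> snd q" using q(1) disj[OF p] by auto
      then have "dist (fst q) (snd q) > 0" by simp
      moreover have "dist (fst q) (snd q) \<le> dist x y" if "x \<in> B (fst p)" "y \<in> B (snd p)" for x y
        using q(2)[of "(x, y)"] that by simp
      ultimately show ?thesis by blast
    next
      case True
      then have "\<forall>x\<in>B (fst p). \<forall>y\<in>B (snd p). 1 \<le> dist x y" by blast
      then show ?thesis using zero_less_one by blast
    qed
  qed
  then have "\<forall>p\<in>R. \<exists>d>0. \<forall>x\<in>B (fst p). \<forall>y\<in>B (snd p). d \<le> dist x y"
    by blast
  from bchoice[OF this] obtain d where
    d: "\<forall>p\<in>R. 0 < d p \<and> (\<forall>x\<in>B (fst p). \<forall>y\<in>B (snd p). d p \<le> dist x y)" by (elim exE)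
  define \<eta> where "\<eta> = Min (insert 1 (d ` R))"
  have fin: "finite (insert 1 (d ` R))" using assms(1) unfolding R_def by simp
  have "\<eta> \<in> insert 1 (d ` R)" unfolding \<eta>_def by (rule Min_in[OF fin]) simp
  then have "\<eta> > 0" using d by auto
  moreover have "\<eta> \<le> dist x y" if "i \<in> I" "j \<in> I" "i \<noteq> j" "x \<in> B i" "y \<in> B j" for i j x y
  proof -
    have ij: "(i, j) \<in> R" using that unfolding R_def by simp
    then have "\<eta> \<le> d (i, j)" unfolding \<eta>_def by (intro Min_le[OF fin]) simp
    also have "\<dots> \<le> dist x y" using bspec[OF d ij] that(4,5) by simp
    finally show ?thesis .
  qed
  ultimately show ?thesis by blast
qed

section \<open>Separated tuples from an independent set\<close>

text \<open>The position of the first occurrence of \<open>i\<close> in the list \<open>l\<close>, with default value \<open>0\<close> if \<open>i\<close> does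
not occur among the first \<open>n\<close> entries. The result is always less than \<open>n\<close> when \<open>n > 0\<close>, whatever the
length of \<open>l\<close>.\<close>
definition first_index :: "nat \<Rightarrow> nat list \<Rightarrow> nat \<Rightarrow> nat" where
  "first_index n l i = (if \<exists>a<n. l ! a = i then LEAST a. l ! a = i else 0)"

lemma first_index_less: "0 < n \<Longrightarrow> first_index n l i < n"
  unfolding first_index_def by (auto intro: le_less_trans[OF Least_le])

lemma first_index_nth:
  assumes "distinct l" "length l = n" "a < n"
  shows "first_index n l (l ! a) = a"
proof -
  have "(LEAST b. l ! b = l ! a) = a"
  proof (rule Least_equality)
    fix b assume b: "l ! b = l ! a"
    show "a \<le> b"
    proof (rule ccontr)
      assume "\<not> a \<le> b"
      then show False using assms b nth_eq_iff_index_eq[of l b a] by auto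
    qed
  qed simp
  then show ?thesis unfolding first_index_def using assms(3) by auto
qed

context folner_group
begin

text \<open>As \<open>|F m|\<close> tends to infinity, a subsequence can be chosen along which each \<open>F (m k)\<close> is much
larger than the union of its predecessors.\<close>
lemma sparse_frequent_subsequence:
  assumes inf: "infinite (carrier G)" and "\<delta> > 0" and freq: "\<exists>\<^sub>F m in sequentially. Q m"
  shows "\<exists>m :: nat \<Rightarrow> nat. strict_mono m \<and> (\<forall>k. Q (m k)) \<and>
    (\<forall>k. real (card (\<Union>j<k. F (m j))) \<le> \<delta> * real (card (F (m k))))"
proof -
  have "\<exists>m. \<forall>k. Q (m k) \<and> (m k < m (Suc k) \<and>
      real (card (\<Union>j\<le>m k. F j)) \<le> \<delta> * real (card (F (m (Suc k)))))"
  proof (rule dependent_nat_choice)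
    show "\<exists>m. Q m" using freq by (rule frequently_ex)
    fix m k :: nat
    obtain C :: nat where C: "real (card (\<Union>j\<le>m. F j)) / \<delta> \<le> real C"
      using real_arch_simple by blast
    have "\<forall>\<^sub>F m' in sequentially. m < m' \<and> C \<le> card (F m')"
      by (intro eventually_conj eventually_gt_at_top card_F_at_top inf)
    from frequently_ex[OF frequently_eventually_conj[OF freq this]]
    obtain m' where m': "m < m'" "C \<le> card (F m')" "Q m'" by blast
    have "real (card (\<Union>j\<le>m. F j)) / \<delta> \<le> real (card (F m'))" using C m'(2) by linarith
    then have "real (card (\<Union>j\<le>m. F j)) \<le> \<delta> * real (card (F m'))"
      using \<open>\<delta> > 0\<close> by (simp add: divide_le_eq mult.commute)
    then show "\<exists>m'. Q m' \<and> (m < m' \<and> real (card (\<Union>j\<le>m. F j)) \<le> \<delta> * real (card (F m')))"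
      using m' by blast
  qed
  then obtain m where m: "\<And>k. Q (m k)" "\<And>k. m k < m (Suc k)"
    "\<And>k. real (card (\<Union>j\<le>m k. F j)) \<le> \<delta> * real (card (F (m (Suc k))))" by blast
  have mono: "strict_mono m" using m(2) by (simp add: strict_mono_Suc_iff)
  moreover have "real (card (\<Union>j<k. F (m j))) \<le> \<delta> * real (card (F (m k)))" for k
  proof (cases k)
    case 0
    then show ?thesis using \<open>\<delta> > 0\<close> by simp
  next
    case (Suc k')
    have "card (\<Union>j<k. F (m j)) \<le> card (\<Union>j\<le>m k'. F j)"
    proof (rule card_mono)
      show "(\<Union>j<k. F (m j)) \<subseteq> (\<Union>j\<le>m k'. F j)"
      proof
        fix h assume "h \<in> (\<Union>j<k. F (m j))"
        then obtain j where j: "j \<le> k'" "h \<in> F (m j)" using Suc by (auto simp: less_Suc_eq_le)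
        then have "m j \<le> m k'" using mono by (simp add: strict_mono_less_eq)
        then show "h \<in> (\<Union>j\<le>m k'. F j)" using j(2) by blast
      qed
    qed simp
    then have "real (card (\<Union>j<k. F (m j))) \<le> real (card (\<Union>j\<le>m k'. F j))" by simp
    also have "\<dots> \<le> \<delta> * real (card (F (m k)))" using m(3)[of k'] Suc by simp
    finally show ?thesis .
  qed
  ultimately show ?thesis using m(1) by blast
qed

text \<open>An independent set \<open>H\<close> of positive upper density yields, in any set \<open>U\<close> into which every
point of \<open>X\<close> is moved by one of finitely many group elements, \<open>n\<close> points of one fibre that, for
infinitely many \<open>m\<close>, are pairwise \<open>\<eta>\<close>-separated at a proportion of at least \<open>\<delta> / 4\<close> of the times in
\<open>F m\<close>. The bound \<open>\<eta> * \<delta> / 4\<close> does not depend on \<open>U\<close> or \<open>K\<close>.\<close>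
lemma sensitive_tuple_of_independent_set:
  fixes X :: "'x::metric_space set" and B :: "nat \<Rightarrow> 'x set"
  assumes inf: "infinite (carrier G)" and "group_action G X act" and n: "n \<ge> 2"
    and eq: "\<And>g x. g \<in> carrier G \<Longrightarrow> x \<in> X \<Longrightarrow> \<pi> (act g x) = actY g (\<pi> x)"
    and H: "H \<subseteq> carrier G" "fibre_independent X act \<pi> {..<n} B H" and "\<delta> > 0"
    and freq: "\<exists>\<^sub>F m in sequentially. \<delta> * real (card (F m)) \<le> real (card (H \<inter> F m))"
    and "\<eta> > 0" and sep: "\<And>i j x y. i < n \<Longrightarrow> j < n \<Longrightarrow> i \<noteq> j \<Longrightarrow> x \<in> B i \<Longrightarrow> y \<in> B j \<Longrightarrow> \<eta> \<le> dist x y"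
    and K: "finite K" "K \<subseteq> carrier G" "\<And>x. x \<in> X \<Longrightarrow> \<exists>k\<in>K. act k x \<in> U"
  shows "\<exists>z. inj_on z {1..n} \<and> z ` {1..n} \<subseteq> U \<and> (\<forall>i\<in>{1..n}. \<forall>j\<in>{1..n}. \<pi> (z i) = \<pi> (z j)) \<and>
    (\<exists>\<^sub>F m in sequentially. \<eta> * \<delta> / 4 \<le>
      (\<Sum>g\<in>F m. Min {dist (act g (z i)) (act g (z j)) | i j. i \<in> {1..n} \<and> j \<in> {1..n} \<and> i \<noteq> j})
        / real (card (F m)))"
proof -
  interpret group_action G X act by fact
  obtain m :: "nat \<Rightarrow> nat" where m: "strict_mono m" "\<And>k. \<delta> * real (card (F (m k))) \<le> real (card (H \<inter> F (m k)))"
    "\<And>k. real (card (\<Union>j<k. F (m j))) \<le> \<delta> / 2 * real (card (F (m k)))"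
    using sparse_frequent_subsequence[OF inf _ freq, of "\<delta> / 2"] \<open>\<delta> > 0\<close> by auto
  define D where "D k = H \<inter> F (m k) - (\<Union>j<k. F (m j))" for k
  have card_D: "\<delta> / 2 * real (card (F (m k))) \<le> real (card (D k))" for k
  proof -
    have "card (H \<inter> F (m k)) \<le> card (D k \<union> (\<Union>j<k. F (m j)))"
      by (rule card_mono) (auto simp: D_def)
    also have "\<dots> \<le> card (D k) + card (\<Union>j<k. F (m j))" by (rule card_Un_le)
    finally show ?thesis using m(2,3)[of k] by linarith
  qed
  define block where "block h = (LEAST k. h \<in> F (m k))" for h
  have block: "block h = k" if "h \<in> D k" for h k
    unfolding block_def
  proof (rule Least_equality)
    show "h \<in> F (m k)" using that unfolding D_def by simp
    show "k \<le> j" if "h \<in> F (m j)" for j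
      using that \<open>h \<in> D k\<close> unfolding D_def by (metis DiffD2 UN_I lessThan_iff not_le)
  qed
  \<comment> \<open>the list attached to block \<open>k\<close>; each list is attached to infinitely many blocks\<close>
  define L :: "nat \<Rightarrow> nat list" where "L k = from_nat (fst (prod_decode k))" for k
  define \<omega> where "\<omega> i h = first_index n (L (block h)) i" for i h
  obtain y where y: "\<And>\<omega>. (\<forall>h. \<omega> h \<in> {..<n}) \<Longrightarrow> \<exists>x\<in>X. \<pi> x = y \<and> (\<forall>h\<in>H. act h x \<in> B (\<omega> h))"
    using H(2) unfolding fibre_independent_def by blast
  have "\<forall>i. \<exists>x. x \<in> X \<and> \<pi> x = y \<and> (\<forall>h\<in>H. act h x \<in> B (\<omega> i h))"
  proof
    fix i
    have "\<forall>h. \<omega> i h \<in> {..<n}" using first_index_less n unfolding \<omega>_def by simp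
    from y[OF this] show "\<exists>x. x \<in> X \<and> \<pi> x = y \<and> (\<forall>h\<in>H. act h x \<in> B (\<omega> i h))"
      by blast
  qed
  from choice[OF this] obtain x where x: "\<And>i. x i \<in> X" "\<And>i. \<pi> (x i) = y"
    "\<And>i h. h \<in> H \<Longrightarrow> act h (x i) \<in> B (\<omega> i h)" by blast
  have "\<exists>k\<in>K. infinite {i \<in> UNIV. act k (x i) \<in> U}"
    by (rule pigeonhole_infinite_rel) (use K x(1) in auto)
  then obtain k0 where k0: "k0 \<in> K" "infinite {i. act k0 (x i) \<in> U}" by auto
  have k0_G: "k0 \<in> carrier G" using k0(1) K(2) by blast
  obtain N where N: "finite N" "card N = n" "N \<subseteq> {i. act k0 (x i) \<in> U}"
    using infinite_arbitrarily_large[OF k0(2)] by blast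
  obtain l where l: "set l = N" "distinct l" using finite_distinct_list[OF N(1)] by blast
  have len: "length l = n" using l N(2) distinct_card by fastforce
  define z where "z i = act k0 (x (l ! (i - 1)))" for i
  have dist_ge: "\<eta> \<le> dist (act g (z i)) (act g (z j))"
    if g: "g \<in> carrier G" "g \<otimes> k0 \<in> D k" and k: "L k = l"
      and ij: "i \<in> {1..n}" "j \<in> {1..n}" "i \<noteq> j" for g k i j
  proof -
    have "act g (z i) \<in> B (i - 1)" if "i \<in> {1..n}" for i
    proof -
      have "act g (z i) = act (g \<otimes> k0) (x (l ! (i - 1)))"
        unfolding z_def using composition_rule[OF x(1) g(1) k0_G] by simp
      moreover have "\<omega> (l ! (i - 1)) (g \<otimes> k0) = i - 1"
        unfolding \<omega>_def block[OF g(2)] k using that by (intro first_index_nth l len) auto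
      moreover have "g \<otimes> k0 \<in> H" using g(2) unfolding D_def by simp
      ultimately show ?thesis using x(3)[of "g \<otimes> k0" "l ! (i - 1)"] by simp
    qed
    then show ?thesis using ij by (intro sep[of "i - 1" "j - 1"]) auto
  qed
  define M where "M g = Min {dist (act g (z i)) (act g (z j)) | i j. i \<in> {1..n} \<and> j \<in> {1..n} \<and> i \<noteq> j}" for g
  have M_ge: "c \<le> M g"
    if "\<And>i j. i \<in> {1..n} \<Longrightarrow> j \<in> {1..n} \<Longrightarrow> i \<noteq> j \<Longrightarrow> c \<le> dist (act g (z i)) (act g (z j))" for c g
  proof -
    let ?A = "{dist (act g (z i)) (act g (z j)) | i j. i \<in> {1..n} \<and> j \<in> {1..n} \<and> i \<noteq> j}"
    have "?A \<subseteq> (\<lambda>(i, j). dist (act g (z i)) (act g (z j))) ` ({1..n} \<times> {1..n})" by auto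
    then have "finite ?A" by (rule finite_subset) simp
    moreover have "1 \<in> {1..n}" "2 \<in> {1..n}" "(1::nat) \<noteq> 2" using n by auto
    then have "?A \<noteq> {}" by blast
    ultimately show ?thesis unfolding M_def using that by (subst Min_ge_iff) auto
  qed
  have "\<forall>\<^sub>F p in sequentially. \<forall>A\<subseteq>F p.
      real (card A) - \<delta> / 4 * real (card (F p)) \<le> real (card {h \<in> F p. h \<otimes> k0 \<in> A})"
    using eventually_right_translate[OF k0_G, of "\<delta> / 4"] \<open>\<delta> > 0\<close> by simp
  then obtain p0 where p0: "\<And>p A. p0 \<le> p \<Longrightarrow> A \<subseteq> F p \<Longrightarrow>
      real (card A) - \<delta> / 4 * real (card (F p)) \<le> real (card {h \<in> F p. h \<otimes> k0 \<in> A})"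
    unfolding eventually_sequentially by blast
  \<comment> \<open>right translation by \<open>k0\<close> costs density \<open>\<delta> / 4\<close>, half of what the block provides\<close>
  have good: "\<delta> / 4 * real (card (F (m k))) \<le> real (card {g \<in> F (m k). g \<otimes> k0 \<in> D k})"
    if "p0 \<le> m k" for k
  proof -
    have "D k \<subseteq> F (m k)" unfolding D_def by blast
    from p0[OF that this] show ?thesis using card_D[of k] by linarith
  qed
  have late: "\<exists>k\<ge>q. L k = l \<and> p0 \<le> m k" for q
  proof -
    define k where "k = prod_encode (to_nat l, max q p0)"
    have "max q p0 \<le> k" unfolding k_def by (rule le_prod_encode_2)
    moreover have "L k = l" unfolding L_def k_def by simp
    moreover have "k \<le> m k" using m(1) by (rule strict_mono_imp_increasing)
    ultimately show ?thesis by (intro exI[of _ k]) auto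
  qed
  have "inj_on z {1..n}"
  proof -
    obtain k where k: "L k = l" "p0 \<le> m k" using late by blast
    have "0 < \<delta> / 4 * real (card (F (m k)))" using \<open>\<delta> > 0\<close> by simp
    then have "0 < card {g \<in> F (m k). g \<otimes> k0 \<in> D k}" using good[OF k(2)] by linarith
    then obtain g where g: "g \<in> F (m k)" "g \<otimes> k0 \<in> D k" by (auto simp: card_gt_0_iff)
    show ?thesis
    proof (rule inj_onI, rule ccontr)
      fix i j assume "i \<in> {1..n}" "j \<in> {1..n}" "z i = z j" "i \<noteq> j"
      then show False using dist_ge[OF _ g(2) k(1), of i j] g(1) F_carrier \<open>\<eta> > 0\<close> by auto
    qed
  qed
  moreover have "z ` {1..n} \<subseteq> U"
  proof
    fix u assume "u \<in> z ` {1..n}"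
    then obtain i where i: "i \<in> {1..n}" "u = z i" by blast
    have "l ! (i - 1) \<in> set l" using i(1) len by (intro nth_mem) auto
    then show "u \<in> U" using N(3) l(1) unfolding i(2) z_def by blast
  qed
  moreover have "\<pi> (z i) = actY k0 y" for i unfolding z_def using eq[OF k0_G x(1)] x(2) by simp
  moreover have "\<exists>\<^sub>F p in sequentially. \<eta> * \<delta> / 4 \<le> (\<Sum>g\<in>F p. M g) / real (card (F p))"
    unfolding frequently_sequentially
  proof
    fix q
    obtain k where k: "q \<le> k" "L k = l" "p0 \<le> m k" using late by blast
    have "k \<le> m k" using m(1) by (rule strict_mono_imp_increasing)
    define good where "good = {g \<in> F (m k). g \<otimes> k0 \<in> D k}"
    have "\<eta> * \<delta> / 4 * real (card (F (m k))) \<le> \<eta> * real (card good)"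
      using mult_left_mono[OF good[OF k(3)], of \<eta>] \<open>\<eta> > 0\<close> unfolding good_def by simp
    also have "\<dots> = (\<Sum>g\<in>good. \<eta>)" by simp
    also have "\<dots> \<le> (\<Sum>g\<in>good. M g)"
    proof (rule sum_mono)
      fix g assume "g \<in> good"
      then have "g \<in> carrier G" "g \<otimes> k0 \<in> D k" unfolding good_def using F_carrier by auto
      then show "\<eta> \<le> M g" using dist_ge[OF _ _ k(2)] by (intro M_ge) blast
    qed
    also have "\<dots> \<le> (\<Sum>g\<in>F (m k). M g)"
      by (rule sum_mono2) (auto simp: good_def intro: M_ge)
    finally have "\<eta> * \<delta> / 4 \<le> (\<Sum>g\<in>F (m k). M g) / real (card (F (m k)))"
      by (simp add: le_divide_eq)
    moreover have "q \<le> m k" using k(1) \<open>k \<le> m k\<close> by simp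
    ultimately show "\<exists>p\<ge>q. \<eta> * \<delta> / 4 \<le> (\<Sum>g\<in>F p. M g) / real (card (F p))" by blast
  qed
  ultimately show ?thesis unfolding M_def by (intro exI[of _ z] conjI ballI) auto
qed

end

section \<open>Relative mean sensitivity\<close>

lemma tds_continuous_on:
  assumes "tds G X act" "g \<in> carrier G"
  shows "continuous_on X (act g)"
proof -
  have "continuous_map (prod_topology (discrete_topology (carrier G)) (top_of_set X)) (top_of_set X)
       (\<lambda>(g, x). act g x)"
    using assms(1) unfolding tds_def by blast
  moreover have "continuous_map (top_of_set X)
      (prod_topology (discrete_topology (carrier G)) (top_of_set X)) (\<lambda>x. (g, x))"
    using assms(2) by (intro continuous_map_pairedI) (auto simp: continuous_map_const)
  ultimately have "continuous_map (top_of_set X) (top_of_set X) ((\<lambda>(g, x). act g x) \<circ> (\<lambda>x. (g, x)))"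
    by (rule continuous_map_compose[rotated])
  then show ?thesis by (simp add: o_def continuous_map_in_subtopology)
qed

lemma minimal_tds_finite_return:
  assumes min: "minimal_tds G X act" and U: "openin (top_of_set X) U" "U \<noteq> {}"
  shows "\<exists>K. finite K \<and> K \<subseteq> carrier G \<and> (\<forall>x\<in>X. \<exists>k\<in>K. act k x \<in> U)"
proof -
  have tds: "tds G X act" and clo: "\<And>x. x \<in> X \<Longrightarrow> top_of_set X closure_of (orbit G act x) = X"
    using min unfolding minimal_tds_def by auto
  then have "compact X" "group_action G X act" unfolding tds_def by auto
  interpret group_action G X act by fact
  define V where "V g = {x \<in> X. act g x \<in> U}" for g
  have V_open: "openin (top_of_set X) (V g)" if g: "g \<in> carrier G" for g
  proof -
    have "act g ` X \<subseteq> X" using surj_prop[OF g] by simp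
    then have "openin (top_of_set X) (X \<inter> act g -` U)"
      using tds_continuous_on[OF tds g] U(1) by (intro continuous_openin_preimage[of X _ X]) auto
    then show ?thesis unfolding V_def by (simp add: Int_def vimage_def)
  qed
  have meets: "\<exists>g\<in>carrier G. x \<in> V g" if x: "x \<in> X" for x
  proof -
    obtain u where u: "u \<in> U" using U(2) by blast
    then have "u \<in> top_of_set X closure_of (orbit G act x)"
      using clo[OF x] openin_subset[OF U(1)] by auto
    then obtain w where "w \<in> orbit G act x" "w \<in> U"
      using u U(1) unfolding in_closure_of by blast
    then show ?thesis using x unfolding orbit_def V_def by blast
  qed
  have "\<forall>C. (\<forall>c\<in>C. openin (top_of_set X) c) \<and> X \<subseteq> \<Union>C \<longrightarrow> (\<exists>D\<subseteq>C. finite D \<and> X \<subseteq> \<Union>D)"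
    using \<open>compact X\<close> unfolding compact_eq_openin_cover .
  moreover have "(\<forall>c\<in>V ` carrier G. openin (top_of_set X) c) \<and> X \<subseteq> \<Union>(V ` carrier G)"
    using V_open meets by blast
  ultimately obtain D where D: "D \<subseteq> V ` carrier G" "finite D" "X \<subseteq> \<Union>D" by meson
  then obtain K where K: "K \<subseteq> carrier G" "finite K" "D = V ` K"
    using finite_subset_image by metis
  have "\<exists>k\<in>K. act k x \<in> U" if "x \<in> X" for x
    using that D(3) unfolding K(3) V_def by blast
  then show ?thesis using K(1,2) by blast
qed

lemma frequently_le_imp_le_limsup:
  fixes f :: "nat \<Rightarrow> 'a :: complete_linorder"
  assumes "\<exists>\<^sub>F m in sequentially. c \<le> f m"
  shows "c \<le> limsup f"
proof (rule ccontr)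
  assume "\<not> c \<le> limsup f"
  then have "\<forall>\<^sub>F m in sequentially. f m < c" by (intro Limsup_lessD) simp
  then show False using assms unfolding frequently_def by (simp add: not_le)
qed

text \<open>Existence of the limit defining the entropy is not needed: the averages are nonnegative,
so if they are not infinitely often bounded away from \<open>0\<close> they converge to \<open>0\<close>, and then the
entropy of the cover is \<open>0\<close>.\<close>
lemma positive_entropy_imp_frequently:
  assumes "rel_top_entropy F X act Y \<pi> > 0"
  shows "\<exists>\<U> c. finite_open_cover X \<U> \<and> c > 0 \<and> (\<exists>\<^sub>F m in sequentially.
    c \<le> rel_cover_entropy X Y \<pi> (cover_Join (F m) (\<lambda>g. translate_cover X act g \<U>))
      / real (card (F m)))"
proof -
  obtain \<U> where \<U>: "finite_open_cover X \<U>" "rel_entropy_cover F X act Y \<pi> \<U> > 0"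
    using assms unfolding rel_top_entropy_def less_SUP_iff by auto
  define a where "a m = rel_cover_entropy X Y \<pi>
    (cover_Join (F m) (\<lambda>g. translate_cover X act g \<U>)) / real (card (F m))" for m
  have a_nonneg: "a m \<ge> 0" for m
  proof -
    have "ln (real N) \<ge> 0" for N :: nat by (cases "N = 0") auto
    then show ?thesis unfolding a_def rel_cover_entropy_def by simp
  qed
  have "\<not> a \<longlonglongrightarrow> 0"
  proof
    assume "a \<longlonglongrightarrow> 0"
    then have "lim a = 0" by (rule limI)
    then show False using \<U>(2) unfolding rel_entropy_cover_def a_def by simp
  qed
  then obtain c where c: "c > 0" "\<not> (\<forall>\<^sub>F m in sequentially. dist (a m) 0 < c)"
    unfolding tendsto_iff by blast
  have "\<exists>\<^sub>F m in sequentially. c \<le> a m"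
    using c(2) a_nonneg unfolding not_eventually by (simp add: not_less)
  then show ?thesis using \<U>(1) c(1) unfolding a_def by blast
qed

theorem corollary5p6:
  fixes G :: "('g, 'b) monoid_scheme"
    and F :: "nat \<Rightarrow> 'g set"
    and X :: "'x::metric_space set" and actX :: "'g \<Rightarrow> 'x \<Rightarrow> 'x"
    and Y :: "'y::metric_space set" and actY :: "'g \<Rightarrow> 'y \<Rightarrow> 'y"
    and \<pi> :: "'x \<Rightarrow> 'y" and n :: nat
  assumes "group G" and "countable (carrier G)" and "infinite (carrier G)" and "amenable G"
    and "folner_sequence G F"
    and "minimal_tds G X actX" and "minimal_tds G Y actY"
    and "factor_map G X actX Y actY \<pi>"
    and "rel_top_entropy F X actX Y \<pi> > 0"
    and "n \<ge> 2"
  shows "rel_mean_sensitive n F X actX \<pi>"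
proof -
  interpret folner_group G F
    using assms(1,5) by (simp add: folner_group_def folner_group_axioms_def)
  have tds: "tds G X actX" and \<pi>: "continuous_on X \<pi>"
    and eq: "\<And>g x. g \<in> carrier G \<Longrightarrow> x \<in> X \<Longrightarrow> \<pi> (actX g x) = actY g (\<pi> x)"
    using assms(8) unfolding factor_map_def by auto
  then have X: "compact X" and action: "group_action G X actX" unfolding tds_def by auto
  interpret group_action G X actX by fact
  obtain \<U> c where \<U>: "finite_open_cover X \<U>" "c > 0"
    "\<exists>\<^sub>F m in sequentially. c \<le> rel_cover_entropy X Y \<pi>
      (cover_Join (F m) (\<lambda>g. translate_cover X actX g \<U>)) / real (card (F m))"
    using positive_entropy_imp_frequently[OF assms(9)] by blast
  have act_X: "actX s x \<in> X" if "s \<in> carrier G" "x \<in> X" for s x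
    using element_image that by blast
  have "\<exists>A \<delta>. (\<forall>v::bool. compact (A v) \<and> A v \<subseteq> X) \<and> A True \<inter> A False = {} \<and> \<delta> > 0 \<and>
    (\<exists>\<^sub>F m in sequentially. \<exists>J\<subseteq>F m. fibre_independent X actX \<pi> UNIV A J \<and>
       \<delta> * real (card (F m)) \<le> real (card J))"
    by (rule positive_entropy_imp_independent_pair[OF X \<U>(1) F_finite F_nonempty _ \<U>(2,3)])
      (use F_carrier act_X in blast)
  then obtain A \<delta> where A: "\<And>v::bool. compact (A v)" "A True \<inter> A False = {}" and \<delta>: "\<delta> > 0"
    and freqJ: "\<exists>\<^sub>F m in sequentially. \<exists>J\<subseteq>F m. fibre_independent X actX \<pi> UNIV A J \<and>
       \<delta> * real (card (F m)) \<le> real (card J)" by auto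
  have n1: "n \<ge> 1" using assms(10) by simp
  obtain S \<epsilon> where S: "S \<subseteq> carrier G" "finite S" "card S = n" and \<epsilon>: "\<epsilon> > 0"
    and freqH: "\<exists>\<^sub>F m in sequentially. \<exists>J H. J \<subseteq> F m \<and> fibre_independent X actX \<pi> UNIV A J \<and>
       H \<subseteq> F m \<and> (\<forall>s\<in>S. \<forall>h\<in>H. s \<otimes>\<^bsub>G\<^esub> h \<in> J) \<and>
       (\<forall>s\<in>S. \<forall>s'\<in>S. \<forall>h\<in>H. \<forall>h'\<in>H. s \<otimes>\<^bsub>G\<^esub> h = s' \<otimes>\<^bsub>G\<^esub> h' \<longrightarrow> h = h') \<and>
       \<epsilon> * real (card (F m)) \<le> real (card H)"
    using disjoint_popular_pattern[OF assms(3) \<delta> n1 freqJ] by blast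
  obtain e where e: "bij_betw e {..<n} S"
    using ex_bij_betw_nat_finite[OF S(2)] S(3) by (auto simp: atLeast0LessThan)
  \<comment> \<open>for \<open>i \<noteq> j\<close> the sets \<open>B i\<close> and \<open>B j\<close> are disjoint because \<open>e i\<close> sends them into \<open>A True\<close> and \<open>A False\<close> respectively\<close>
  define B where "B i = {x \<in> X. \<forall>s\<in>S. actX s x \<in> A (s = e i)}" for i
  have B_compact: "compact (B i)" for i
  proof -
    have "B i = X \<inter> (\<Inter>s\<in>S. X \<inter> actX s -` A (s = e i))" unfolding B_def by auto
    also have "compact \<dots>"
      using S(1) by (intro compact_Int_closed X closed_INT ballI continuous_closed_preimage
          tds_continuous_on[OF tds] compact_imp_closed A) auto
    finally show ?thesis .
  qed
  have B_disj: "B i \<inter> B j = {}" if "i \<in> {..<n}" "j \<in> {..<n}" "i \<noteq> j" for i j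
  proof -
    have "e i \<in> S" "e i \<noteq> e j"
      using e that unfolding bij_betw_def by (auto dest: inj_onD)
    then show ?thesis using A(2) unfolding B_def by fastforce
  qed
  have "\<exists>\<eta>>0. \<forall>i\<in>{..<n}. \<forall>j\<in>{..<n}. i \<noteq> j \<longrightarrow> (\<forall>x\<in>B i. \<forall>y\<in>B j. \<eta> \<le> dist x y)"
    by (rule pairwise_disjoint_compact_separated[OF finite_lessThan B_compact B_disj])
  then obtain \<eta> where \<eta>: "\<eta> > 0"
    and sep: "\<And>i j x y. i < n \<Longrightarrow> j < n \<Longrightarrow> i \<noteq> j \<Longrightarrow> x \<in> B i \<Longrightarrow> y \<in> B j \<Longrightarrow> \<eta> \<le> dist x y"
    by auto
  define P where "P H \<longleftrightarrow> H \<subseteq> carrier G \<and> fibre_independent X actX \<pi> {..<n} B H" for H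
  have "\<exists>H\<subseteq>carrier G. (\<forall>A. finite A \<longrightarrow> A \<subseteq> H \<longrightarrow> P A) \<and>
    (\<exists>\<^sub>F m in sequentially. \<epsilon> / 2 * real (card (F m)) \<le> real (card (H \<inter> F m)))"
  proof (rule infinite_set_of_positive_upper_density[OF _ _ \<epsilon>])
    show "P H'" if "P H" "H' \<subseteq> H" for H H'
      using that fibre_independent_mono[of X actX \<pi> "{..<n}" B H H'] unfolding P_def by blast
    show "P {h \<in> carrier G. h \<otimes>\<^bsub>G\<^esub> g \<in> H}" if "P H" "g \<in> carrier G" for H g
    proof -
      have "fibre_independent X actX \<pi> {..<n} B {h \<in> carrier G. h \<otimes>\<^bsub>G\<^esub> g \<in> H}"
        by (rule fibre_independent_translate[where actY = actY, OF action])
          (use that eq[OF that(2)] in \<open>simp_all add: P_def\<close>)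
      then show ?thesis unfolding P_def by blast
    qed
    show "\<exists>\<^sub>F m in sequentially. \<exists>H\<subseteq>F m. P H \<and> \<epsilon> * real (card (F m)) \<le> real (card H)"
      using freqH
    proof (rule frequently_elim1)
      fix m assume "\<exists>J H. J \<subseteq> F m \<and> fibre_independent X actX \<pi> UNIV A J \<and>
       H \<subseteq> F m \<and> (\<forall>s\<in>S. \<forall>h\<in>H. s \<otimes>\<^bsub>G\<^esub> h \<in> J) \<and>
       (\<forall>s\<in>S. \<forall>s'\<in>S. \<forall>h\<in>H. \<forall>h'\<in>H. s \<otimes>\<^bsub>G\<^esub> h = s' \<otimes>\<^bsub>G\<^esub> h' \<longrightarrow> h = h') \<and>
       \<epsilon> * real (card (F m)) \<le> real (card H)"
      then obtain J H where J: "fibre_independent X actX \<pi> UNIV A J" and H: "H \<subseteq> F m"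
        and *: "\<forall>s\<in>S. \<forall>h\<in>H. s \<otimes>\<^bsub>G\<^esub> h \<in> J"
         "\<forall>s\<in>S. \<forall>s'\<in>S. \<forall>h\<in>H. \<forall>h'\<in>H. s \<otimes>\<^bsub>G\<^esub> h = s' \<otimes>\<^bsub>G\<^esub> h' \<longrightarrow> h = h'"
        and card: "\<epsilon> * real (card (F m)) \<le> real (card H)" by blast
      have HG: "H \<subseteq> carrier G" using H F_carrier by blast
      have "fibre_independent X actX \<pi> {..<n} B H"
        unfolding B_def
        by (rule fibre_independent_pattern[OF action S(1) HG J]) (use * in blast)+
      then show "\<exists>H\<subseteq>F m. P H \<and> \<epsilon> * real (card (F m)) \<le> real (card H)"
        using H HG card unfolding P_def by blast
    qed
  qed
  then obtain H where H: "H \<subseteq> carrier G" "\<And>A. finite A \<Longrightarrow> A \<subseteq> H \<Longrightarrow> P A"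
    and dens: "\<exists>\<^sub>F m in sequentially. \<epsilon> / 2 * real (card (F m)) \<le> real (card (H \<inter> F m))" by blast
  have indep: "fibre_independent X actX \<pi> {..<n} B H"
  proof (rule fibre_independent_of_finite_subsets[OF X _ \<pi>])
    show "continuous_on X (actX h)" if "h \<in> H" for h
      using tds_continuous_on[OF tds] that H(1) by blast
    show "closed (B i)" for i using B_compact by (rule compact_imp_closed)
    show "fibre_independent X actX \<pi> {..<n} B A" if "finite A" "A \<subseteq> H" for A
      using H(2)[OF that] unfolding P_def by blast
  qed
  have \<epsilon>2: "\<epsilon> / 2 > 0" using \<epsilon> by simp
  define \<kappa> where "\<kappa> = \<eta> * (\<epsilon> / 2) / 4"
  have \<kappa>: "\<kappa> > 0" unfolding \<kappa>_def using \<eta> \<epsilon> by simp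
  define avg where "avg z m = (\<Sum>g\<in>F m. Min {dist (actX g (z i)) (actX g (z j)) | i j.
      i \<in> {1..n} \<and> j \<in> {1..n} \<and> i \<noteq> j}) / real (card (F m))" for z :: "nat \<Rightarrow> 'x" and m
  show ?thesis unfolding rel_mean_sensitive_def
  proof (rule exI[of _ "\<kappa> / 2"], intro conjI allI impI)
    show "\<kappa> / 2 > 0" using \<kappa> by simp
    fix U assume U: "openin (top_of_set X) U \<and> U \<noteq> {}"
    have "\<exists>K. finite K \<and> K \<subseteq> carrier G \<and> (\<forall>x\<in>X. \<exists>k\<in>K. actX k x \<in> U)"
      by (rule minimal_tds_finite_return[OF assms(6)]) (use U in auto)
    then obtain K where K: "finite K" "K \<subseteq> carrier G" "\<And>x. x \<in> X \<Longrightarrow> \<exists>k\<in>K. actX k x \<in> U"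
      by metis
    have "\<exists>z. inj_on z {1..n} \<and> z ` {1..n} \<subseteq> U \<and> (\<forall>i\<in>{1..n}. \<forall>j\<in>{1..n}. \<pi> (z i) = \<pi> (z j)) \<and>
        (\<exists>\<^sub>F m in sequentially. \<kappa> \<le> avg z m)"
      unfolding \<kappa>_def avg_def
      by (rule sensitive_tuple_of_independent_set[where actY = actY and \<pi> = \<pi>,
          OF assms(3) action assms(10) eq H(1) indep \<epsilon>2 dens \<eta> sep K])
    then obtain z where z: "inj_on z {1..n}" "z ` {1..n} \<subseteq> U"
        "\<forall>i\<in>{1..n}. \<forall>j\<in>{1..n}. \<pi> (z i) = \<pi> (z j)"
      and freq: "\<exists>\<^sub>F m in sequentially. \<kappa> \<le> avg z m" by (elim exE conjE)
    have "ereal (\<kappa> / 2) < ereal \<kappa>" using \<kappa> by simp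
    also have "\<dots> \<le> limsup (\<lambda>m. ereal (avg z m))"
      by (rule frequently_le_imp_le_limsup) (use freq in simp)
    finally have lim: "limsup (\<lambda>m. ereal (avg z m)) > ereal (\<kappa> / 2)" .
    show "\<exists>x. inj_on x {1..n} \<and> x ` {1..n} \<subseteq> U \<and>
        (\<forall>i\<in>{1..n}. \<forall>j\<in>{1..n}. \<pi> (x i) = \<pi> (x j)) \<and>
        limsup (\<lambda>m. ereal ((\<Sum>g\<in>F m. Min {dist (actX g (x i)) (actX g (x j)) | i j.
          i \<in> {1..n} \<and> j \<in> {1..n} \<and> i \<noteq> j}) / real (card (F m)))) > ereal (\<kappa> / 2)"
      by (rule exI[of _ z]) (intro conjI z lim[unfolded avg_def])
  qed
qed

end
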